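(* Fix $k\ge2$, let $q=q(n)$ satisfy $n^{-2/(k-1)}\ll q\ll n^{-2/k}$, and let $H\sim G(n,q)$. Then $$\frac{\nu_k(H)-\mathbb E\,\nu_k(H)}{\sqrt{\mu_k(n,q)}}\xrightarrow{\mathrm d}\mathcal N(0,1),\qquad \operatorname{Var}\bigl(\nu_k(H)\bigr)\sim\mu_k(n,q).$$
   Context: All asymptotics are as $n\to\infty$; $f\ll g$ means $f/g\to0$ and $f\sim g$ means $f/g\to1$. $G(n,q)$ is the binomial random graph on $[n]$. For a graph $H$ and an integer $k\ge2$, $\nu_k(H)$ is the maximum number of pairwise vertex-disjoint copies of $K_k$ in $H$. $\mu_k(n,q):=\binom nk q^{\binom k2}$. $\xrightarrow{\mathrm d}$ denotes convergence in distribution. *)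

theory Defs
  imports
    "HOL-Probability.Probability"
    "HOL-Library.Ramsey"
    "HOL-Library.Disjoint_Sets"
    "HOL-Library.Landau_Symbols"
begin

text \<open>A simple graph is given by its vertex set and its edge set, the edges being two-element
  sets of vertices.\<close>

type_synonym 'a sgraph = "'a set \<times> 'a set set"

definition gnp :: "nat \<Rightarrow> real \<Rightarrow> nat sgraph pmf" where
  "gnp n q =
     map_pmf (\<lambda>present. ({1..n}, {e \<in> nsets {1..n} 2. present e}))
       (Pi_pmf (nsets {1..n} 2) False (\<lambda>_. bernoulli_pmf q))"

text \<open>A copy of the complete graph on \<open>k\<close> vertices in a graph is determined by its vertex set,
  so copies are represented by the \<open>k\<close>-sets of vertices all of whose pairs are edges.\<close>

definition clique_copies :: "nat \<Rightarrow> 'a sgraph \<Rightarrow> 'a set set" where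
  "clique_copies k H = {S \<in> nsets (fst H) k. nsets S 2 \<subseteq> snd H}"

text \<open>The set below contains \<open>0\<close> (the empty family) and is finite whenever \<open>H\<close> has finitely many
  vertices, so that the maximum is then attained.\<close>

definition clique_packing_number :: "nat \<Rightarrow> 'a sgraph \<Rightarrow> nat" where
  "clique_packing_number k H = Max {card F | F. F \<subseteq> clique_copies k H \<and> disjoint F}"

definition clique_mean :: "nat \<Rightarrow> nat \<Rightarrow> real \<Rightarrow> real" where
  "clique_mean k n q = real (n choose k) * q ^ (k choose 2)"

end

theory Submission
  imports Defs
begin

text \<open>
  Write \<open>X\<close> for the number of copies of \<open>K\<^sub>k\<close> and \<open>\<mu>\<close> for its mean. The upper bound on \<open>q\<close>
  says exactly that, compared with \<open>\<mu>\<close>, the expected number \<open>Q\<close> of ordered pairs of distinct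
  copies sharing a vertex is negligible (\<open>clique_overlap_bound\<close>, \<open>overlap_ratio_tendsto_0\<close>); the
  lower bound says that \<open>\<mu>\<close> tends to infinity (\<open>clique_mean_at_top\<close>). Thus most copies are
  disjoint from all the others, and \<open>\<nu>\<^sub>k = X - D\<close> for a deficit \<open>D\<close> that is of mean \<open>o(\<mu>)\<close>. A bound
  on the mean of \<open>D\<close> is too weak, as \<open>D\<close> need not be of smaller order than \<open>sqrt \<mu>\<close>; what is
  needed is that the variance of \<open>D\<close> is \<open>o(\<mu>)\<close>. The proof has two independent halves.

  The count \<open>X\<close> behaves like a Poisson variable of large mean. Conditioning on the
  presence of one copy adds that copy and hardly any other, whence
  \<open>E[X f(X)]\<close> is close to \<open>\<mu> E[f(X + 1)]\<close> for Lipschitz \<open>f\<close> (\<open>size_bias_identity\<close>).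
  The choice \<open>f(x) = x\<close> gives \<open>Var X \<sim> \<mu>\<close>. Complex exponentials for \<open>f\<close> give an approximate
  differential equation \<open>\<phi>'(t) = - t \<phi>(t)\<close> for the characteristic function of the standardised
  count; its solution is the Gaussian characteristic function (\<open>char_count_approx\<close>).

  The deficit is handled by the Efron--Stein inequality (\<open>Efron_Stein_random_subset\<close>). Switching one
  edge on changes \<open>D\<close> only through new copies that meet another copy, so the squared
  change is at most twice the number of overlapping pairs whose first member uses that edge. Summed over
  the edges this bounds \<open>Var D\<close> by a constant times \<open>Q\<close> (\<open>variance_packing_deficit\<close>).

  Since \<open>Var D = o(\<mu>)\<close>, subtracting \<open>D - E D\<close> changes neither the variance of \<open>X\<close> to first order
  nor the limit of the characteristic functions, and the continuity theorem of Levy concludes.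
\<close>

section \<open>Random subsets of a finite set\<close>

text \<open>The edge set of \<open>G(n, q)\<close> is a random subset of the set of all pairs. The arguments below concern
  arbitrary finite ground sets, which makes induction on the ground set available.\<close>

definition random_subset :: "'a set \<Rightarrow> real \<Rightarrow> 'a set pmf" where
  "random_subset A q =
     map_pmf (\<lambda>present. {e \<in> A. present e}) (Pi_pmf A False (\<lambda>_. bernoulli_pmf q))"

abbreviation subset_mean ::
  "'a set \<Rightarrow> real \<Rightarrow> ('a set \<Rightarrow> 'b) \<Rightarrow> 'b::{banach, second_countable_topology}" where
  "subset_mean A q f \<equiv> measure_pmf.expectation (random_subset A q) f"

lemma set_random_subset: "set_pmf (random_subset A q) \<subseteq> Pow A"
  by (auto simp: random_subset_def)

lemma finite_set_random_subset [simp]: "finite A \<Longrightarrow> finite (set_pmf (random_subset A q))"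
  by (meson finite_Pow_iff finite_subset set_random_subset)

lemma integrable_random_subset [simp]:
  fixes f :: "'a set \<Rightarrow> 'b::{banach, second_countable_topology}"
  shows "finite A \<Longrightarrow> integrable (random_subset A q) f"
  by (simp add: integrable_measure_pmf_finite)

lemma subset_mean_cong:
  assumes "\<And>G. G \<subseteq> A \<Longrightarrow> f G = g G"
  shows "subset_mean A q f = subset_mean A q g"
  using assms set_random_subset[of A q] by (intro integral_cong_AE) (auto simp: AE_measure_pmf_iff)

lemma subset_mean_mono:
  fixes f g :: "'a set \<Rightarrow> real"
  assumes "finite A" "\<And>G. G \<subseteq> A \<Longrightarrow> f G \<le> g G"
  shows "subset_mean A q f \<le> subset_mean A q g"
  using assms set_random_subset[of A q] by (intro integral_mono_AE) (auto simp: AE_measure_pmf_iff)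

text \<open>Exposing one element is the only fact about the product measure that is used: every identity
  for means below follows from this recursion.\<close>

lemma subset_mean_insert:
  assumes "finite A" "e \<notin> A" "0 \<le> q" "q \<le> 1"
  shows "subset_mean (insert e A) q f
    = q *\<^sub>R subset_mean A q (\<lambda>G. f (insert e G)) + (1 - q) *\<^sub>R subset_mean A q f"
proof -
  have set_eq: "{x. (x = e \<or> x \<in> A) \<and> (g(e := b)) x} = (if b then insert e {x \<in> A. g x} else {x \<in> A. g x})"
    for g :: "'a \<Rightarrow> bool" and b using assms(2) by (cases b) auto
  have "random_subset (insert e A) q = bernoulli_pmf q \<bind>
      (\<lambda>b. map_pmf (\<lambda>G. if b then insert e G else G) (random_subset A q))"
    using assms(1,2) unfolding random_subset_def
    by (simp add: Pi_pmf_insert' map_bind_pmf set_eq pmf.map_comp o_def if_distrib[of return_pmf]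
          map_pmf_def bind_assoc_pmf bind_return_pmf del: fun_upd_apply)
  then have "subset_mean (insert e A) q f = (\<Sum>b\<in>UNIV. pmf (bernoulli_pmf q) b *\<^sub>R
      measure_pmf.expectation (map_pmf (\<lambda>G. if b then insert e G else G) (random_subset A q)) f)"
    using assms(1) by (simp only:) (rule pmf_expectation_bind; simp)
  then show ?thesis
    using assms(3,4) by (simp add: UNIV_bool)
qed

lemma subset_mean_force_element:
  assumes "finite A" "e \<in> A" "0 \<le> q" "q \<le> 1"
  shows "subset_mean A q (\<lambda>G. if e \<in> G then f G else 0) = q *\<^sub>R subset_mean A q (\<lambda>G. f (insert e G))"
proof -
  obtain B where B: "A = insert e B" "e \<notin> B"
    using assms(2) by (meson Set.set_insert)
  have "subset_mean B q (\<lambda>G. if e \<in> G then f G else 0) = subset_mean B q (\<lambda>_. 0)"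
    using B by (intro subset_mean_cong) auto
  then show ?thesis
    using assms B by (simp add: subset_mean_insert scaleR_left_diff_distrib)
qed

text \<open>Conditioned on \<open>B \<subseteq> G\<close>, the set \<open>G\<close> is distributed as \<open>G \<union> B\<close> for an unconditioned \<open>G\<close>. This is the
  coupling that lets a conditional mean be computed on the original space.\<close>

lemma subset_mean_force:
  assumes "finite A" "B \<subseteq> A" "0 \<le> q" "q \<le> 1"
  shows "subset_mean A q (\<lambda>G. if B \<subseteq> G then f G else 0)
    = q ^ card B *\<^sub>R subset_mean A q (\<lambda>G. f (G \<union> B))"
proof -
  have "finite B" using assms finite_subset by blast
  then show ?thesis using assms(2)
  proof (induction B arbitrary: f)
    case (insert b B)
    have "subset_mean A q (\<lambda>G. if insert b B \<subseteq> G then f G else 0)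
        = subset_mean A q (\<lambda>G. if b \<in> G then (if B \<subseteq> G then f G else 0) else 0)"
      by (intro subset_mean_cong) auto
    also have "\<dots> = q *\<^sub>R subset_mean A q (\<lambda>G. if B \<subseteq> insert b G then f (insert b G) else 0)"
      using insert.prems assms by (subst subset_mean_force_element) auto
    also have "subset_mean A q (\<lambda>G. if B \<subseteq> insert b G then f (insert b G) else 0)
        = subset_mean A q (\<lambda>G. if B \<subseteq> G then f (insert b G) else 0)"
      using insert.hyps by (intro subset_mean_cong) (simp add: subset_insert)
    also have "\<dots> = q ^ card B *\<^sub>R subset_mean A q (\<lambda>G. f (insert b (G \<union> B)))"
      using insert.IH[of "\<lambda>G. f (insert b G)"] insert.prems by simp
    finally show ?case
      using insert.hyps by simp
  qed simp
qed

corollary subset_mean_superset: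
  assumes "finite A" "B \<subseteq> A" "0 \<le> q" "q \<le> 1"
  shows "subset_mean A q (\<lambda>G. if B \<subseteq> G then 1 else 0 :: real) = q ^ card B"
  using subset_mean_force[OF assms, of "\<lambda>_. 1 :: real"] by simp

text \<open>Exposing the element \<open>x\<close> splits the variance of \<open>f\<close> into the averaged variance of the two
  restrictions of \<open>f\<close>, which induction controls, and \<open>q (1 - q)\<close> times the squared difference of their
  means, which Jensen's inequality bounds by the mean squared influence of \<open>x\<close>.\<close>

theorem Efron_Stein_random_subset:
  fixes f :: "'a set \<Rightarrow> real"
  assumes "finite A" "0 \<le> q" "q \<le> 1"
  shows "measure_pmf.variance (random_subset A q) f
    \<le> (\<Sum>e\<in>A. q * subset_mean A q (\<lambda>G. (f (insert e G) - f (G - {e}))\<^sup>2))"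
  using assms(1)
proof (induction A arbitrary: f)
  case empty
  show ?case by (simp add: random_subset_def map_pmf_const)
next
  case (insert x A)
  let ?E = "subset_mean A q :: ('a set \<Rightarrow> real) \<Rightarrow> real" and ?V = "\<lambda>f. measure_pmf.variance (random_subset A q) f"
  let ?g = "\<lambda>G. f (insert x G)"
  have var: "?V h = ?E (\<lambda>G. (h G)\<^sup>2) - (?E h)\<^sup>2" for h :: "'a set \<Rightarrow> real"
    using insert.hyps by (simp add: measure_pmf.variance_eq)
  have "measure_pmf.variance (random_subset (insert x A) q) f
      = subset_mean (insert x A) q (\<lambda>G. (f G)\<^sup>2) - (subset_mean (insert x A) q f)\<^sup>2"
    using insert.hyps by (simp add: measure_pmf.variance_eq)
  also have "\<dots> = q * ?E (\<lambda>G. (?g G)\<^sup>2) + (1 - q) * ?E (\<lambda>G. (f G)\<^sup>2) - (q * ?E ?g + (1 - q) * ?E f)\<^sup>2"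
    using insert.hyps assms(2,3) by (simp add: subset_mean_insert)
  also have "\<dots> = q * ?V ?g + (1 - q) * ?V f + q * (1 - q) * (?E ?g - ?E f)\<^sup>2"
    unfolding var by (simp add: power2_eq_square algebra_simps)
  finally have split: "measure_pmf.variance (random_subset (insert x A) q) f
      = q * ?V ?g + (1 - q) * ?V f + q * (1 - q) * (?E ?g - ?E f)\<^sup>2" .
  \<comment> \<open>Jensen's inequality for the square, as nonnegativity of a variance.\<close>
  have "0 \<le> ?V (\<lambda>G. ?g G - f G)" by simp
  then have "(?E ?g - ?E f)\<^sup>2 \<le> ?E (\<lambda>G. (?g G - f G)\<^sup>2)"
    unfolding var using insert.hyps by simp
  then have "q * (?E ?g - ?E f)\<^sup>2 \<le> q * ?E (\<lambda>G. (?g G - f G)\<^sup>2)"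
    using assms(2) by (rule mult_left_mono)
  moreover have "q * (1 - q) * (?E ?g - ?E f)\<^sup>2 \<le> q * 1 * (?E ?g - ?E f)\<^sup>2"
    using assms(2,3) by (intro mult_right_mono mult_left_mono) auto
  ultimately have top: "q * (1 - q) * (?E ?g - ?E f)\<^sup>2 \<le> q * ?E (\<lambda>G. (?g G - f G)\<^sup>2)"
    by linarith
  have x_eq: "subset_mean (insert x A) q (\<lambda>G. (f (insert x G) - f (G - {x}))\<^sup>2)
      = ?E (\<lambda>G. (?g G - f G)\<^sup>2)"
  proof -
    have "?E (\<lambda>G. (f (insert x G) - f (G - {x}))\<^sup>2) = ?E (\<lambda>G. (?g G - f G)\<^sup>2)"
    proof (intro subset_mean_cong)
      fix G assume "G \<subseteq> A"
      then have "G - {x} = G" using insert.hyps by auto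
      then show "(f (insert x G) - f (G - {x}))\<^sup>2 = (?g G - f G)\<^sup>2" by simp
    qed
    moreover have "?E (\<lambda>G. (f (insert x G) - f (insert x G - {x}))\<^sup>2) = ?E (\<lambda>G. (?g G - f G)\<^sup>2)"
    proof (intro subset_mean_cong)
      fix G assume "G \<subseteq> A"
      then have "insert x G - {x} = G" using insert.hyps by auto
      then show "(f (insert x G) - f (insert x G - {x}))\<^sup>2 = (?g G - f G)\<^sup>2" by simp
    qed
    ultimately show ?thesis
      using insert.hyps assms(2,3) by (simp add: subset_mean_insert algebra_simps)
  qed
  have e_eq: "subset_mean (insert x A) q (\<lambda>G. (f (insert e G) - f (G - {e}))\<^sup>2)
      = q * ?E (\<lambda>G. (?g (insert e G) - ?g (G - {e}))\<^sup>2)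
        + (1 - q) * ?E (\<lambda>G. (f (insert e G) - f (G - {e}))\<^sup>2)" if "e \<in> A" for e
  proof -
    have "e \<noteq> x" using that insert.hyps by auto
    then have "insert x G - {e} = insert x (G - {e})" for G by auto
    then show ?thesis
      using insert.hyps assms(2,3) by (simp add: subset_mean_insert insert_commute)
  qed
  have "q * ?V ?g \<le> q * (\<Sum>e\<in>A. q * ?E (\<lambda>G. (?g (insert e G) - ?g (G - {e}))\<^sup>2))"
    "(1 - q) * ?V f \<le> (1 - q) * (\<Sum>e\<in>A. q * ?E (\<lambda>G. (f (insert e G) - f (G - {e}))\<^sup>2))"
    using insert.IH[of ?g] insert.IH[of f] assms(2,3) by (auto intro!: mult_left_mono)
  note lower = this
  have "(\<Sum>e\<in>insert x A. q * subset_mean (insert x A) q (\<lambda>G. (f (insert e G) - f (G - {e}))\<^sup>2))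
      = q * ?E (\<lambda>G. (?g G - f G)\<^sup>2)
        + (\<Sum>e\<in>A. q * (q * ?E (\<lambda>G. (?g (insert e G) - ?g (G - {e}))\<^sup>2)
            + (1 - q) * ?E (\<lambda>G. (f (insert e G) - f (G - {e}))\<^sup>2)))"
    unfolding sum.insert[OF insert.hyps(1,2)] x_eq by (simp only: e_eq cong: sum.cong)
  also have "\<dots> = q * ?E (\<lambda>G. (?g G - f G)\<^sup>2)
        + q * (\<Sum>e\<in>A. q * ?E (\<lambda>G. (?g (insert e G) - ?g (G - {e}))\<^sup>2))
        + (1 - q) * (\<Sum>e\<in>A. q * ?E (\<lambda>G. (f (insert e G) - f (G - {e}))\<^sup>2))"
    unfolding sum_distrib_left add.assoc sum.distrib[symmetric]
    by (intro arg_cong2[where f = "(+)"] sum.cong refl) (simp add: algebra_simps)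
  finally show ?case
    unfolding split using lower top by linarith
qed

section \<open>Counting the members of a family contained in a random set\<close>

text \<open>The members are indexed, so that the vertex sets of cliques can serve as indices for the
  edge sets that have to be present.\<close>

locale random_subset_family =
  fixes A :: "'a set" and q :: real and I :: "'i set" and E :: "'i \<Rightarrow> 'a set"
  assumes finite_ground: "finite A" and q_nonneg: "0 \<le> q" and q_le_1: "q \<le> 1"
    and finite_index: "finite I" and member_subset: "i \<in> I \<Longrightarrow> E i \<subseteq> A"
begin

definition count :: "'a set \<Rightarrow> real" where
  "count G = real (card {i \<in> I. E i \<subseteq> G})"

definition mean_count :: real where
  "mean_count = (\<Sum>i\<in>I. q ^ card (E i))"

definition neighbours :: "'i \<Rightarrow> 'i set" where
  "neighbours i = {j \<in> I. j \<noteq> i \<and> E i \<inter> E j \<noteq> {}}"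

text \<open>The error term of Chen--Stein type: the squared probabilities of single members plus the joint
  probabilities of pairs of distinct members that have a ground element in common.\<close>

definition dependence :: real where
  "dependence = (\<Sum>i\<in>I. (q ^ card (E i))\<^sup>2 + (\<Sum>j\<in>neighbours i. q ^ card (E i \<union> E j)))"

lemma finite_neighbours [simp]: "finite (neighbours i)"
  using finite_index by (simp add: neighbours_def)

lemma mean_count_nonneg: "0 \<le> mean_count"
  using q_nonneg by (auto simp: mean_count_def intro!: sum_nonneg)

lemma dependence_nonneg: "0 \<le> dependence"
  using q_nonneg by (auto simp: dependence_def intro!: sum_nonneg add_nonneg_nonneg)

lemma count_scaleR: "count G *\<^sub>R x = (\<Sum>i\<in>I. if E i \<subseteq> G then x else 0)"
  for x :: "'b::real_vector"
  using finite_index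
  by (simp add: count_def sum.inter_filter[symmetric] sum_constant_scaleR)

lemma mean_of_count: "subset_mean A q count = mean_count"
proof -
  have "count = (\<lambda>G. \<Sum>i\<in>I. if E i \<subseteq> G then 1 else 0)"
    using count_scaleR[where x = "1 :: real"] by auto
  then show ?thesis
    using member_subset finite_ground q_nonneg q_le_1
    by (simp add: mean_count_def subset_mean_superset cong: sum.cong)
qed

text \<open>Forcing the \<open>i\<close>-th member creates that member, unless it was present, together with members that
  share an element with it; all other members are unaffected.\<close>

lemma count_Un_member:
  assumes "i \<in> I"
  shows "\<bar>count (G \<union> E i) - (count G + 1)\<bar>
    \<le> (if E i \<subseteq> G then 1 else 0) + (\<Sum>j\<in>neighbours i. if E j \<subseteq> G \<union> E i then 1 else 0)"
proof -
  let ?P = "{j \<in> I. E j \<subseteq> G}" and ?P' = "{j \<in> I. E j \<subseteq> G \<union> E i}"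
  have nn: "0 \<le> (\<Sum>j\<in>neighbours i. if E j \<subseteq> G \<union> E i then 1 else 0 :: real)"
    by (intro sum_nonneg) auto
  show ?thesis
  proof (cases "E i \<subseteq> G")
    case True
    then have "G \<union> E i = G" by auto
    with True nn show ?thesis by simp
  next
    case False
    have grow: "count (G \<union> E i) = count G + real (card (?P' - ?P))"
    proof -
      have "card ?P' = card ?P + card (?P' - ?P)"
        using finite_index by (subst card_Un_disjoint[symmetric]) (auto intro: arg_cong[where f = card])
      then show ?thesis by (simp add: count_def)
    qed
    have "card (?P' - ?P) = Suc (card (?P' - ?P - {i}))"
      using assms False finite_index by (intro card.remove) auto
    with grow have "\<bar>count (G \<union> E i) - (count G + 1)\<bar> = real (card (?P' - ?P - {i}))"
      by simp
    also have "card (?P' - ?P - {i}) \<le> card {j \<in> neighbours i. E j \<subseteq> G \<union> E i}"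
      using finite_index by (intro card_mono) (auto simp: neighbours_def)
    also have "real (card {j \<in> neighbours i. E j \<subseteq> G \<union> E i})
        = (\<Sum>j\<in>neighbours i. if E j \<subseteq> G \<union> E i then 1 else 0)"
      by (simp add: sum.inter_filter[symmetric])
    finally show ?thesis
      using False by simp
  qed
qed

lemma scaled_mean_Un_member:
  assumes "i \<in> I" "j \<in> I"
  shows "q ^ card (E i) * subset_mean A q (\<lambda>G. if E j \<subseteq> G \<union> E i then 1 else 0) = q ^ card (E i \<union> E j)"
proof -
  have "q ^ card (E i) * subset_mean A q (\<lambda>G. if E j \<subseteq> G \<union> E i then 1 else 0)
      = subset_mean A q (\<lambda>G. if E i \<subseteq> G then (if E j \<subseteq> G then 1 else 0) else 0 :: real)"
    using subset_mean_force[OF finite_ground member_subset[OF assms(1)] q_nonneg q_le_1,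
        of "\<lambda>G. if E j \<subseteq> G then 1 else 0 :: real"] by simp
  also have "\<dots> = subset_mean A q (\<lambda>G. if E i \<union> E j \<subseteq> G then 1 else 0)"
    by (intro subset_mean_cong) auto
  also have "\<dots> = q ^ card (E i \<union> E j)"
    using member_subset assms by (intro subset_mean_superset finite_ground q_nonneg q_le_1) auto
  finally show ?thesis .
qed

text \<open>By linearity and \<open>subset_mean_force\<close>, \<open>E[X f(X)]\<close> is the sum over \<open>i\<close> of the probability of the \<open>i\<close>-th
  member times the mean of \<open>f\<close> at the count with that member forced; the latter count differs from \<open>X + 1\<close> by
  the amount in \<open>count_Un_member\<close>. For a Poisson variable the two sides agree exactly.\<close>

theorem size_bias_identity:
  fixes f :: "real \<Rightarrow> 'b::{banach, second_countable_topology}"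
  assumes lip: "\<And>x y. norm (f x - f y) \<le> L * \<bar>x - y\<bar>"
  shows "norm (subset_mean A q (\<lambda>G. count G *\<^sub>R f (count G))
      - mean_count *\<^sub>R subset_mean A q (\<lambda>G. f (count G + 1))) \<le> L * dependence"
proof -
  note [simp] = finite_ground
  have L: "0 \<le> L" using order_trans[OF norm_ge_zero lip[of 1 0]] by simp
  have "subset_mean A q (\<lambda>G. count G *\<^sub>R f (count G))
      = (\<Sum>i\<in>I. subset_mean A q (\<lambda>G. if E i \<subseteq> G then f (count G) else 0))"
    by (simp add: count_scaleR)
  also have "\<dots> = (\<Sum>i\<in>I. q ^ card (E i) *\<^sub>R subset_mean A q (\<lambda>G. f (count (G \<union> E i))))"
    using member_subset q_nonneg q_le_1 by (intro sum.cong refl subset_mean_force) auto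
  finally have "norm (subset_mean A q (\<lambda>G. count G *\<^sub>R f (count G))
      - mean_count *\<^sub>R subset_mean A q (\<lambda>G. f (count G + 1)))
    = norm (\<Sum>i\<in>I. q ^ card (E i) *\<^sub>R subset_mean A q (\<lambda>G. f (count (G \<union> E i)) - f (count G + 1)))"
    by (simp add: mean_count_def scaleR_sum_left sum_subtractf scaleR_diff_right)
  also have "\<dots> \<le> (\<Sum>i\<in>I. L * ((q ^ card (E i))\<^sup>2 + (\<Sum>j\<in>neighbours i. q ^ card (E i \<union> E j))))"
  proof (intro order.trans[OF norm_sum] sum_mono)
    fix i assume i: "i \<in> I"
    have "norm (subset_mean A q (\<lambda>G. f (count (G \<union> E i)) - f (count G + 1)))
        \<le> subset_mean A q (\<lambda>G. norm (f (count (G \<union> E i)) - f (count G + 1)))"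
      by (rule integral_norm_bound)
    also have "\<dots> \<le> subset_mean A q (\<lambda>G. L * ((if E i \<subseteq> G then 1 else 0)
        + (\<Sum>j\<in>neighbours i. if E j \<subseteq> G \<union> E i then 1 else 0)))"
      using order.trans[OF lip mult_left_mono[OF count_Un_member[OF i] L]]
      by (intro subset_mean_mono) auto
    also have "\<dots> = L * (subset_mean A q (\<lambda>G. if E i \<subseteq> G then 1 else 0)
        + (\<Sum>j\<in>neighbours i. subset_mean A q (\<lambda>G. if E j \<subseteq> G \<union> E i then 1 else 0)))"
      by simp
    finally have "q ^ card (E i) * norm (subset_mean A q (\<lambda>G. f (count (G \<union> E i)) - f (count G + 1)))
      \<le> q ^ card (E i) * (L * (subset_mean A q (\<lambda>G. if E i \<subseteq> G then 1 else 0)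
        + (\<Sum>j\<in>neighbours i. subset_mean A q (\<lambda>G. if E j \<subseteq> G \<union> E i then 1 else 0))))"
      using q_nonneg by (intro mult_left_mono) auto
    also have "\<dots> = L * (q ^ card (E i) * subset_mean A q (\<lambda>G. if E i \<subseteq> G then 1 else 0)
        + (\<Sum>j\<in>neighbours i. q ^ card (E i) * subset_mean A q (\<lambda>G. if E j \<subseteq> G \<union> E i then 1 else 0)))"
      by (simp add: algebra_simps sum_distrib_left)
    also have "\<dots> = L * ((q ^ card (E i))\<^sup>2 + (\<Sum>j\<in>neighbours i. q ^ card (E i \<union> E j)))"
    proof -
      have "subset_mean A q (\<lambda>G. if E i \<subseteq> G then 1 else 0 :: real) = q ^ card (E i)"
        using i member_subset q_nonneg q_le_1 by (intro subset_mean_superset) auto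
      moreover have "(\<Sum>j\<in>neighbours i. q ^ card (E i) * subset_mean A q (\<lambda>G. if E j \<subseteq> G \<union> E i then 1 else 0))
          = (\<Sum>j\<in>neighbours i. q ^ card (E i \<union> E j))"
        using i by (intro sum.cong refl scaled_mean_Un_member) (auto simp: neighbours_def)
      ultimately show ?thesis by (simp add: power2_eq_square)
    qed
    finally show "norm (q ^ card (E i) *\<^sub>R subset_mean A q (\<lambda>G. f (count (G \<union> E i)) - f (count G + 1)))
        \<le> L * ((q ^ card (E i))\<^sup>2 + (\<Sum>j\<in>neighbours i. q ^ card (E i \<union> E j)))"
      using q_nonneg by simp
  qed
  also have "\<dots> = L * dependence"
    by (simp add: dependence_def sum_distrib_left)
  finally show ?thesis .
qed

text \<open>The identity function turns \<open>E[X f(X)]\<close> into the second moment.\<close>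

corollary variance_count: "\<bar>measure_pmf.variance (random_subset A q) count - mean_count\<bar> \<le> dependence"
proof -
  note [simp] = finite_ground
  have "measure_pmf.variance (random_subset A q) count - mean_count
     = subset_mean A q (\<lambda>G. count G *\<^sub>R count G) - mean_count *\<^sub>R subset_mean A q (\<lambda>G. count G + 1)"
    by (simp add: measure_pmf.variance_eq mean_of_count power2_eq_square algebra_simps)
  then show ?thesis
    using size_bias_identity[of "\<lambda>x. x" 1] by simp
qed

end

lemma iexp_Lipschitz: "norm (iexp x - iexp y) \<le> \<bar>x - y\<bar>"
proof -
  have "iexp x - iexp y = iexp y * (iexp (x - y) - 1)"
    by (simp add: algebra_simps flip: exp_add)
  then have "norm (iexp x - iexp y) = norm (iexp (x - y) - 1)"
    by (simp add: norm_mult)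
  then show ?thesis using iexp_approx1[of "x - y" 0] by simp
qed

text \<open>The product \<open>\<phi>(s) exp(s\<^sup>2/2)\<close> is constant for exact solutions; here its derivative is small, and the
  mean value inequality applies.\<close>

lemma near_exp_of_approximate_ode:
  fixes \<phi> \<phi>' :: "real \<Rightarrow> complex"
  assumes deriv: "\<And>s. (\<phi> has_vector_derivative \<phi>' s) (at s)"
    and ode: "\<And>s. \<bar>s\<bar> \<le> \<bar>t\<bar> \<Longrightarrow> norm (\<phi>' s + of_real s * \<phi> s) \<le> \<eta>"
    and "\<phi> 0 = 1"
  shows "norm (\<phi> t - of_real (exp (- t\<^sup>2 / 2))) \<le> \<eta> * \<bar>t\<bar>"
proof -
  define h where "h s = \<phi> s * of_real (exp (s\<^sup>2 / 2))" for s
  have \<eta>: "0 \<le> \<eta>" using order_trans[OF norm_ge_zero ode[of 0]] by simp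
  have dh: "(h has_vector_derivative (\<phi>' s + of_real s * \<phi> s) * of_real (exp (s\<^sup>2 / 2))) (at s)" for s
  proof -
    have "((\<lambda>s. exp (s\<^sup>2 / 2) :: real) has_real_derivative exp (s\<^sup>2 / 2) * s) (at s)"
      by (auto intro!: derivative_eq_intros)
    then have "((\<lambda>s. of_real (exp (s\<^sup>2 / 2)) :: complex) has_vector_derivative of_real (exp (s\<^sup>2 / 2) * s)) (at s)"
      by (intro has_vector_derivative_of_real) (simp add: has_real_derivative_iff_has_vector_derivative)
    from has_vector_derivative_mult[OF deriv this] show ?thesis
      unfolding h_def by (simp add: algebra_simps)
  qed
  have "norm (h t - h 0) \<le> \<eta> * exp (t\<^sup>2 / 2) * norm (t - 0)"
  proof (rule differentiable_bound[where S = "{- \<bar>t\<bar>..\<bar>t\<bar>}"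
        and f' = "\<lambda>s d. d *\<^sub>R ((\<phi>' s + of_real s * \<phi> s) * of_real (exp (s\<^sup>2 / 2)))"])
    fix s assume s: "s \<in> {- \<bar>t\<bar>..\<bar>t\<bar>}"
    show "(h has_derivative (\<lambda>d. d *\<^sub>R ((\<phi>' s + of_real s * \<phi> s) * of_real (exp (s\<^sup>2 / 2)))))
        (at s within {- \<bar>t\<bar>..\<bar>t\<bar>})"
      using dh[of s] unfolding has_vector_derivative_def by (rule has_derivative_at_withinI)
    have "norm ((\<phi>' s + of_real s * \<phi> s) * of_real (exp (s\<^sup>2 / 2))) \<le> \<eta> * exp (t\<^sup>2 / 2)"
    proof -
      have "\<bar>s\<bar> \<le> \<bar>t\<bar>" using s by auto
      then have "norm (\<phi>' s + of_real s * \<phi> s) \<le> \<eta>" "s\<^sup>2 \<le> t\<^sup>2"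
        using ode by (auto simp: abs_le_square_iff)
      then show ?thesis unfolding norm_mult using \<eta> by (intro mult_mono) auto
    qed
    then show "onorm (\<lambda>d. d *\<^sub>R ((\<phi>' s + of_real s * \<phi> s) * of_real (exp (s\<^sup>2 / 2)))) \<le> \<eta> * exp (t\<^sup>2 / 2)"
      using \<eta> by (intro onorm_bound) (auto simp: mult.commute[of _ "\<bar>_\<bar>"] norm_mult intro!: mult_left_mono \<eta>)
  qed auto
  then have "norm ((h t - h 0) * of_real (exp (- t\<^sup>2 / 2))) \<le> \<eta> * exp (t\<^sup>2 / 2) * \<bar>t\<bar> * exp (- t\<^sup>2 / 2)"
    using \<eta> unfolding norm_mult by (intro mult_mono) auto
  moreover have "(h t - h 0) * of_real (exp (- t\<^sup>2 / 2)) = \<phi> t - of_real (exp (- t\<^sup>2 / 2))"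
    using \<open>\<phi> 0 = 1\<close> by (simp add: h_def algebra_simps flip: of_real_mult exp_add)
  moreover have "\<eta> * exp (t\<^sup>2 / 2) * \<bar>t\<bar> * exp (- t\<^sup>2 / 2) = \<eta> * \<bar>t\<bar>"
    by (simp add: mult_ac flip: exp_add)
  ultimately show ?thesis by (simp only:)
qed

context random_subset_family begin

text \<open>Differentiating under the (finite) mean gives \<open>\<phi>'(s) = \<i> E[W exp(\<i> s W)]\<close> with \<open>W\<close> the standardised count.
  As \<open>W\<close> is affine in \<open>X\<close>, the size-bias identity applies to \<open>X exp(\<i> s W)\<close>, and
  shifting \<open>X\<close> by \<open>1\<close> multiplies the exponential by \<open>exp(\<i> s / sqrt \<mu>)\<close>. The second-order Taylor
  remainder of that factor and the dependence are the two error terms.\<close>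

theorem char_count_approx:
  assumes "0 < mean_count"
  shows "norm (subset_mean A q (\<lambda>G. iexp (t * ((count G - mean_count) / sqrt mean_count)))
      - of_real (exp (- t\<^sup>2 / 2)))
    \<le> (t\<^sup>2 / (2 * sqrt mean_count) + \<bar>t\<bar> * dependence / mean_count) * \<bar>t\<bar>"
proof -
  note [simp] = finite_ground
  define r where "r = sqrt mean_count"
  have r: "0 < r" "mean_count = r * r" using assms by (auto simp: r_def)
  define W where "W G = (count G - mean_count) / r" for G
  define \<phi> where "\<phi> s = subset_mean A q (\<lambda>G. iexp (s * W G))" for s
  define \<phi>' where "\<phi>' s = subset_mean A q (\<lambda>G. \<i> * (W G *\<^sub>R iexp (s * W G)))" for s
  have "norm (\<phi> t - of_real (exp (- t\<^sup>2 / 2))) \<le> (t\<^sup>2 / (2 * r) + \<bar>t\<bar> * dependence / mean_count) * \<bar>t\<bar>"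
  proof (rule near_exp_of_approximate_ode)
    show "\<phi> 0 = 1" by (simp add: \<phi>_def)
    fix s :: real
    have sum_form: "subset_mean A q f = (\<Sum>G\<in>set_pmf (random_subset A q). pmf (random_subset A q) G *\<^sub>R f G)"
      for f :: "'a set \<Rightarrow> complex"
      by (rule integral_measure_pmf) auto
    have "((\<lambda>s. iexp (s * W G)) has_vector_derivative \<i> * (W G *\<^sub>R iexp (s * W G))) (at s)" for G
    proof -
      have "((\<lambda>s. s * W G) has_vector_derivative W G) (at s)"
        by (auto intro!: derivative_eq_intros)
      from vector_diff_chain_at[OF this has_vector_derivative_iexp, unfolded o_def]
      show ?thesis by (simp add: mult_ac scaleR_conv_of_real)
    qed
    then show "(\<phi> has_vector_derivative \<phi>' s) (at s)"
      unfolding \<phi>_def \<phi>'_def sum_form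
      by (intro has_vector_derivative_sum bounded_linear.has_vector_derivative[OF bounded_linear_scaleR_right])
  next
    fix s :: real assume s: "\<bar>s\<bar> \<le> \<bar>t\<bar>"
    define f where "f x = iexp (s * ((x - mean_count) / r))" for x
    have lip: "norm (f x - f y) \<le> (\<bar>s\<bar> / r) * \<bar>x - y\<bar>" for x y
    proof -
      have "norm (f x - f y) \<le> \<bar>s * ((x - mean_count) / r) - s * ((y - mean_count) / r)\<bar>"
        unfolding f_def by (rule iexp_Lipschitz)
      also have "s * ((x - mean_count) / r) - s * ((y - mean_count) / r) = s / r * (x - y)"
        using r(1) by (simp add: field_simps)
      finally show ?thesis using r(1) by (simp add: abs_mult)
    qed
    have f_shift: "f (x + 1) = iexp (s / r) * f x" for x
      using r(1) by (simp add: f_def flip: exp_add) (simp add: field_simps)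
    have mean_f: "subset_mean A q (\<lambda>G. f (count G)) = \<phi> s"
      by (simp add: \<phi>_def f_def W_def)
    \<comment> \<open>The error of the size-bias identity and the Taylor remainder of the shift factor.\<close>
    define err1 where "err1 = subset_mean A q (\<lambda>G. count G *\<^sub>R f (count G))
        - mean_count *\<^sub>R (iexp (s / r) * \<phi> s)"
    define err2 where "err2 = iexp (s / r) - 1 - \<i> * of_real (s / r)"
    have "norm err1 \<le> \<bar>s\<bar> / r * dependence"
      using size_bias_identity[of f, OF lip] by (simp add: err1_def f_shift mean_f)
    moreover have "\<bar>s\<bar> / r * dependence \<le> \<bar>t\<bar> / r * dependence"
      using s r(1) dependence_nonneg by (intro mult_right_mono divide_right_mono) auto
    ultimately have e1: "norm (err1 / r) \<le> \<bar>t\<bar> * dependence / mean_count"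
      using r by (simp add: norm_divide field_simps)
    have "norm err2 \<le> (s / r)\<^sup>2 / 2"
      using iexp_approx1[of "s / r" 1] by (simp add: err2_def algebra_simps power2_eq_square)
    then have "norm err2 * norm (\<phi> s) \<le> (s / r)\<^sup>2 / 2 * 1"
    proof (intro mult_mono)
      have "norm (\<phi> s) \<le> subset_mean A q (\<lambda>G. norm (iexp (s * W G)))"
        unfolding \<phi>_def by (rule integral_norm_bound)
      then show "norm (\<phi> s) \<le> 1" by simp
    qed auto
    then have "norm (r *\<^sub>R (err2 * \<phi> s)) \<le> r * ((s / r)\<^sup>2 / 2)"
      using r(1) by (simp add: norm_mult)
    also have "\<dots> = s\<^sup>2 / (2 * r)" using r(1) by (simp add: field_simps power2_eq_square)
    also have "\<dots> \<le> t\<^sup>2 / (2 * r)" using s r(1) by (intro divide_right_mono) (auto simp: abs_le_square_iff)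
    finally have e2: "norm (r *\<^sub>R (err2 * \<phi> s)) \<le> t\<^sup>2 / (2 * r)" .
    have "\<phi>' s = \<i> * subset_mean A q (\<lambda>G. W G *\<^sub>R f (count G))"
      unfolding \<phi>'_def f_def W_def by (rule integral_mult_right_zero)
    also have "subset_mean A q (\<lambda>G. W G *\<^sub>R f (count G))
        = subset_mean A q (\<lambda>G. (count G *\<^sub>R f (count G) - mean_count *\<^sub>R f (count G)) /\<^sub>R r)"
      by (intro subset_mean_cong) (simp add: W_def scaleR_conv_of_real divide_inverse algebra_simps)
    also have "\<dots> = (err1 + mean_count *\<^sub>R (iexp (s / r) * \<phi> s) - mean_count *\<^sub>R \<phi> s) / r"
      by (simp add: err1_def mean_f scaleR_conv_of_real divide_inverse)
    finally have "\<phi>' s + of_real s * \<phi> s = \<i> * (err1 / r) + \<i> * (r *\<^sub>R (err2 * \<phi> s))"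
      using r(1) unfolding r(2) err2_def by (simp add: scaleR_conv_of_real field_simps)
    then have "norm (\<phi>' s + of_real s * \<phi> s) \<le> norm (err1 / r) + norm (r *\<^sub>R (err2 * \<phi> s))"
      by (metis norm_triangle_ineq norm_mult norm_ii mult_1)
    with e1 e2 show "norm (\<phi>' s + of_real s * \<phi> s) \<le> t\<^sup>2 / (2 * r) + \<bar>t\<bar> * dependence / mean_count"
      by linarith
  qed
  then show ?thesis by (simp add: \<phi>_def W_def r_def)
qed

end

section \<open>The packing deficit\<close>

definition disjoint_number :: "'a set set \<Rightarrow> nat" where
  "disjoint_number B = Max {card F | F. F \<subseteq> B \<and> disjoint F}"

definition packing_deficit :: "'a set set \<Rightarrow> real" where
  "packing_deficit B = real (card B) - real (disjoint_number B)"

lemma finite_disjoint_cards: "finite B \<Longrightarrow> finite {card F | F. F \<subseteq> B \<and> disjoint F}"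
  by (rule finite_subset[of _ "card ` Pow B"]) auto

lemma card_le_disjoint_number:
  assumes "finite B" "F \<subseteq> B" "disjoint F"
  shows "card F \<le> disjoint_number B"
  unfolding disjoint_number_def using assms by (intro Max_ge finite_disjoint_cards) auto

lemma disjoint_number_attained:
  assumes "finite B"
  obtains F where "F \<subseteq> B" "disjoint F" "card F = disjoint_number B"
proof -
  have "disjoint_number B \<in> {card F | F. F \<subseteq> B \<and> disjoint F}"
    unfolding disjoint_number_def using assms
    by (intro Max_in finite_disjoint_cards) (auto intro!: exI[of _ "{}"] simp: disjoint_def)
  then show thesis using that by auto
qed

text \<open>Enlarging the family cannot lower the deficit, as a packing grows by at most the number of new members.
  Conversely, a new member that meets nothing else can be added to any packing, so only new
  members that meet another member contribute to the deficit.\<close>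

lemma packing_deficit_increment:
  fixes A B :: "'a set set"
  assumes "finite B" "A \<subseteq> B"
  defines "M \<equiv> {S \<in> B - A. \<exists>T\<in>B. T \<noteq> S \<and> S \<inter> T \<noteq> {}}"
  shows "0 \<le> packing_deficit B - packing_deficit A"
    and "packing_deficit B - packing_deficit A \<le> card M"
proof -
  have fin: "finite A" "finite (B - A)" "finite M"
    using assms finite_subset by (auto simp: M_def)
  have card_B: "card B = card A + card (B - A)"
    using assms(2) fin by (metis assms(1) card_mono card_Diff_subset le_add_diff_inverse)
  obtain F where F: "F \<subseteq> B" "disjoint F" "card F = disjoint_number B"
    using disjoint_number_attained[OF assms(1)] .
  have "card F = card (F \<inter> A) + card (F - A)"
    using F(1) finite_subset[OF _ assms(1)] by (metis card_Int_Diff)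
  moreover have "card (F \<inter> A) \<le> disjoint_number A"
    using F(2) fin by (intro card_le_disjoint_number) (auto simp: disjoint_def)
  moreover have "card (F - A) \<le> card (B - A)"
    using F(1) fin by (intro card_mono) auto
  ultimately show "0 \<le> packing_deficit B - packing_deficit A"
    using card_B F(3) by (simp add: packing_deficit_def)
  obtain F' where F': "F' \<subseteq> A" "disjoint F'" "card F' = disjoint_number A"
    using disjoint_number_attained[OF fin(1)] .
  have isolated: "S \<inter> T = {}" if "S \<in> B - A - M" "T \<in> B" "T \<noteq> S" for S T
    using that by (auto simp: M_def)
  have "disjoint (F' \<union> (B - A - M))"
  proof (rule disjointI)
    fix S T assume *: "S \<in> F' \<union> (B - A - M)" "T \<in> F' \<union> (B - A - M)" "S \<noteq> T"
    then consider "S \<in> F'" "T \<in> F'" | "S \<in> B - A - M" | "T \<in> B - A - M" by blast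
    then show "S \<inter> T = {}"
    proof cases
      case 1 then show ?thesis using F'(2) *(3) by (auto dest: disjointD)
    next
      case 2 then show ?thesis using isolated[of S T] * F'(1) assms(2) by blast
    next
      case 3 then show ?thesis using isolated[of T S] * F'(1) assms(2) by blast
    qed
  qed
  then have "card (F' \<union> (B - A - M)) \<le> disjoint_number B"
    using F'(1) assms by (intro card_le_disjoint_number) auto
  moreover have "card (F' \<union> (B - A - M)) = card F' + card (B - A - M)"
    using F'(1) fin by (intro card_Un_disjoint) (auto intro: finite_subset)
  moreover have "card (B - A) = card (B - A - M) + card M"
  proof -
    have "B - A = (B - A - M) \<union> M" by (auto simp: M_def)
    then show ?thesis using fin by (metis Diff_disjoint Int_commute card_Un_disjoint finite_Diff)
  qed
  ultimately show "packing_deficit B - packing_deficit A \<le> card M"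
    using card_B F'(3) by (simp add: packing_deficit_def)
qed

text \<open>The square counts pairs of contributing new members. If all new members meet each other, as cliques
  through a common edge do, then such a pair is itself an intersecting pair or has equal entries, and
  each contributing member has a partner.\<close>

lemma packing_deficit_increment_sq:
  fixes A B :: "'a set set"
  assumes "finite B" "A \<subseteq> B"
    and meet: "\<And>S T. S \<in> B - A \<Longrightarrow> T \<in> B - A \<Longrightarrow> S \<inter> T \<noteq> {}"
  shows "(packing_deficit B - packing_deficit A)\<^sup>2
    \<le> 2 * real (card {(S, T). S \<in> B - A \<and> T \<in> B \<and> T \<noteq> S \<and> S \<inter> T \<noteq> {}})"
proof -
  define M where "M = {S \<in> B - A. \<exists>T\<in>B. T \<noteq> S \<and> S \<inter> T \<noteq> {}}"
  define R where "R = {(S, T). S \<in> B - A \<and> T \<in> B \<and> T \<noteq> S \<and> S \<inter> T \<noteq> {}}"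
  have fin: "finite R" "finite M"
    using assms(1) by (intro finite_subset[of R "B \<times> B"]; auto simp: R_def)
      (simp add: M_def assms(1))
  have "M \<subseteq> fst ` R"
  proof
    fix S assume "S \<in> M"
    then obtain T where "(S, T) \<in> R" by (auto simp: M_def R_def)
    then show "S \<in> fst ` R" by (metis fst_conv imageI)
  qed
  then have "card M \<le> card R" by (rule surj_card_le[OF fin(1)])
  moreover have "card (M \<times> M) \<le> card ((\<lambda>S. (S, S)) ` M) + card R"
  proof -
    \<comment> \<open>A pair off the diagonal is an intersecting pair, and the diagonal is no larger than their number.\<close>
    have "M \<times> M \<subseteq> (\<lambda>S. (S, S)) ` M \<union> R"
    proof clarify
      fix S T assume "S \<in> M" "T \<in> M" "(S, T) \<notin> R"
      then have "S = T" using meet[of S T] unfolding M_def R_def by blast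
      then show "(S, T) \<in> (\<lambda>S. (S, S)) ` M" using \<open>S \<in> M\<close> by simp
    qed
    then have "card (M \<times> M) \<le> card ((\<lambda>S. (S, S)) ` M \<union> R)"
      using fin by (intro card_mono) auto
    then show ?thesis using card_Un_le order.trans by blast
  qed
  moreover have "card ((\<lambda>S. (S, S)) ` M) \<le> card M" using fin(2) by (rule card_image_le)
  ultimately have "(card M)\<^sup>2 \<le> 2 * card R"
    by (simp add: card_cartesian_product power2_eq_square)
  then have "(real (card M))\<^sup>2 \<le> 2 * real (card R)"
    by (metis of_nat_le_iff of_nat_mult of_nat_numeral of_nat_power)
  moreover have "(packing_deficit B - packing_deficit A)\<^sup>2 \<le> (real (card M))\<^sup>2"
    using packing_deficit_increment[OF assms(1,2)] unfolding M_def by (intro power_mono) auto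
  ultimately show ?thesis unfolding R_def by linarith
qed

lemma finite_clique_copies: "finite V \<Longrightarrow> finite (clique_copies k (V, G))"
  by (simp add: clique_copies_def finite_imp_finite_nsets)

lemma clique_packing_number_eq: "clique_packing_number k H = disjoint_number (clique_copies k H)"
  by (simp add: clique_packing_number_def disjoint_number_def)

text \<open>The expected number of ordered pairs of distinct copies with a common vertex.\<close>

definition clique_overlap :: "nat \<Rightarrow> nat \<Rightarrow> real \<Rightarrow> real" where
  "clique_overlap k n q = (\<Sum>S\<in>nsets {1..n} k. \<Sum>T\<in>{T \<in> nsets {1..n} k. T \<noteq> S \<and> S \<inter> T \<noteq> {}}.
     q ^ card (nsets S 2 \<union> nsets T 2))"

text \<open>In the Efron--Stein sum, the factor \<open>q\<close> turns the mean with the edge \<open>e\<close> forced into the mean over graphs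
  containing \<open>e\<close>, so the pair \<open>(S, T)\<close> contributes its probability once for each edge of \<open>S\<close>.\<close>

lemma variance_packing_deficit:
  assumes "0 \<le> q" "q \<le> 1"
  shows "measure_pmf.variance (random_subset (nsets {1..n} 2) q)
      (\<lambda>G. packing_deficit (clique_copies k ({1..n}, G)))
    \<le> 2 * real (k choose 2) * clique_overlap k n q"
proof -
  let ?A = "nsets {1..n} 2" and ?K = "nsets {1..n} k"
  let ?c = "\<lambda>G. clique_copies k ({1..n}, G)"
  let ?N = "\<lambda>S. {T \<in> ?K. T \<noteq> S \<and> S \<inter> T \<noteq> {}}"
  let ?I = "\<lambda>S T G. if nsets S 2 \<union> nsets T 2 \<subseteq> G then 1 else 0 :: real"
  note [simp] = finite_imp_finite_nsets
  have step: "(packing_deficit (?c (insert e G)) - packing_deficit (?c (G - {e})))\<^sup>2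
      \<le> 2 * (\<Sum>S\<in>{S \<in> ?K. e \<in> nsets S 2}. \<Sum>T\<in>?N S. ?I S T (insert e G))"
    if e: "e \<in> ?A" for e G
  proof -
    have new: "S \<in> ?K \<and> e \<in> nsets S 2" if "S \<in> ?c (insert e G) - ?c (G - {e})" for S
      using that by (auto simp: clique_copies_def)
    have "(packing_deficit (?c (insert e G)) - packing_deficit (?c (G - {e})))\<^sup>2
      \<le> 2 * real (card {(S, T). S \<in> ?c (insert e G) - ?c (G - {e}) \<and> T \<in> ?c (insert e G)
          \<and> T \<noteq> S \<and> S \<inter> T \<noteq> {}})"
    proof (rule packing_deficit_increment_sq)
      fix S T assume "S \<in> ?c (insert e G) - ?c (G - {e})" "T \<in> ?c (insert e G) - ?c (G - {e})"
      then have "e \<subseteq> S" "e \<subseteq> T" using new by (auto simp: nsets_def)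
      moreover have "e \<noteq> {}" using e by (auto simp: nsets_def)
      ultimately show "S \<inter> T \<noteq> {}" by blast
    qed (auto simp: finite_clique_copies, auto simp: clique_copies_def)
    also have "card {(S, T). S \<in> ?c (insert e G) - ?c (G - {e}) \<and> T \<in> ?c (insert e G)
          \<and> T \<noteq> S \<and> S \<inter> T \<noteq> {}}
        \<le> card (SIGMA S:{S \<in> ?K. e \<in> nsets S 2}. {T \<in> ?N S. nsets S 2 \<union> nsets T 2 \<subseteq> insert e G})"
      using new by (intro card_mono finite_SigmaI) (auto simp: clique_copies_def)
    also have "real \<dots> = (\<Sum>S\<in>{S \<in> ?K. e \<in> nsets S 2}. \<Sum>T\<in>?N S. ?I S T (insert e G))"
      by (simp add: sum.inter_filter[symmetric])
    finally show ?thesis by simp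
  qed
  have edge_term: "q * subset_mean ?A q (\<lambda>G. ?I S T (insert e G)) = q ^ card (nsets S 2 \<union> nsets T 2)"
    if "e \<in> ?A" "e \<in> nsets S 2" "S \<in> ?K" "T \<in> ?K" for e S T
  proof -
    have "q * subset_mean ?A q (\<lambda>G. ?I S T (insert e G)) = subset_mean ?A q (\<lambda>G. if e \<in> G then ?I S T G else 0)"
      using subset_mean_force_element[of ?A e q "?I S T"] that assms by simp
    also have "\<dots> = subset_mean ?A q (?I S T)"
      using that by (intro subset_mean_cong) auto
    also have "\<dots> = q ^ card (nsets S 2 \<union> nsets T 2)"
      using that assms by (intro subset_mean_superset) (auto simp: nsets_def)
    finally show ?thesis .
  qed
  have "measure_pmf.variance (random_subset ?A q) (\<lambda>G. packing_deficit (?c G))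
      \<le> (\<Sum>e\<in>?A. q * subset_mean ?A q (\<lambda>G. (packing_deficit (?c (insert e G)) - packing_deficit (?c (G - {e})))\<^sup>2))"
    by (rule Efron_Stein_random_subset) (use assms in auto)
  also have "\<dots> \<le> (\<Sum>e\<in>?A. q * subset_mean ?A q (\<lambda>G. 2 * (\<Sum>S\<in>{S \<in> ?K. e \<in> nsets S 2}. \<Sum>T\<in>?N S. ?I S T (insert e G))))"
    using step assms(1) by (intro sum_mono mult_left_mono subset_mean_mono) auto
  also have "\<dots> = (\<Sum>e\<in>?A. 2 * (\<Sum>S\<in>{S \<in> ?K. e \<in> nsets S 2}. \<Sum>T\<in>?N S.
      q * subset_mean ?A q (\<lambda>G. ?I S T (insert e G))))"
    by (simp add: sum_distrib_left mult_ac)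
  also have "\<dots> = (\<Sum>e\<in>?A. 2 * (\<Sum>S\<in>{S \<in> ?K. e \<in> nsets S 2}. \<Sum>T\<in>?N S. q ^ card (nsets S 2 \<union> nsets T 2)))"
    by (intro sum.cong refl arg_cong2[where f = "(*)"] edge_term) auto
  also have "\<dots> = 2 * (\<Sum>S\<in>?K. \<Sum>e\<in>{e \<in> ?A. e \<in> nsets S 2}. \<Sum>T\<in>?N S. q ^ card (nsets S 2 \<union> nsets T 2))"
    unfolding sum_distrib_left[symmetric] by (subst sum.swap_restrict) auto
  also have "\<dots> = 2 * (\<Sum>S\<in>?K. real (k choose 2) * (\<Sum>T\<in>?N S. q ^ card (nsets S 2 \<union> nsets T 2)))"
  proof -
    have "card {e \<in> ?A. e \<in> nsets S 2} = k choose 2" if "S \<in> ?K" for S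
    proof -
      have "{e \<in> ?A. e \<in> nsets S 2} = nsets S 2" using that by (auto simp: nsets_def)
      then show ?thesis using that by (simp add: nsets_def[of _ k])
    qed
    then show ?thesis by simp
  qed
  finally show ?thesis by (simp add: clique_overlap_def sum_distrib_left mult_ac)
qed

section \<open>The number of overlapping pairs of cliques\<close>

text \<open>Such a set is determined by its trace on \<open>S\<close> and by its part outside \<open>S\<close>.\<close>

lemma card_nsets_meeting_in:
  assumes "finite V" "S \<subseteq> V" "v \<le> k"
  shows "card {T \<in> nsets V k. card (S \<inter> T) = v} \<le> (card S choose v) * card V ^ (k - v)"
proof -
  have fin: "finite S" using assms finite_subset by blast
  let ?f = "\<lambda>T. (S \<inter> T, T - S)"
  have "card {T \<in> nsets V k. card (S \<inter> T) = v} \<le> card (nsets S v \<times> nsets V (k - v))"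
  proof (rule card_inj_on_le[of ?f])
    show "inj_on ?f {T \<in> nsets V k. card (S \<inter> T) = v}"
      by (rule inj_onI) blast
    show "?f ` {T \<in> nsets V k. card (S \<inter> T) = v} \<subseteq> nsets S v \<times> nsets V (k - v)"
      using fin by (auto simp: nsets_def card_Diff_subset_Int Int_commute)
    show "finite (nsets S v \<times> nsets V (k - v))"
      using fin assms by (auto simp: finite_imp_finite_nsets)
  qed
  also have "\<dots> \<le> (card S choose v) * card V ^ (k - v)"
  proof -
    have "m choose r \<le> m ^ r" for m r :: nat
      by (rule order.trans[OF _ binomial_fact_pow]) simp
    then show ?thesis by (simp add: card_cartesian_product)
  qed
  finally show ?thesis .
qed

lemma card_nsets_2_Un:
  assumes "finite S" "finite T"
  shows "card (nsets S 2 \<union> nsets T 2) + (card (S \<inter> T) choose 2) = (card S choose 2) + (card T choose 2)"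
proof -
  have "nsets S 2 \<inter> nsets T 2 = nsets (S \<inter> T) 2" by (auto simp: nsets_def)
  then show ?thesis
    using card_Un_Int[of "nsets S 2" "nsets T 2"] assms by (simp add: finite_imp_finite_nsets)
qed

lemma choose_two_diff:
  assumes "v \<le> k"
  shows "2 * ((k choose 2) - (v choose 2)) = (k - v) * (k + v - 1)"
proof -
  obtain d where k: "k = v + d" using assms le_Suc_ex by blast
  have "2 * (m choose 2) = m * (m - 1)" for m :: nat by (cases m) (simp_all add: choose_two)
  then have "2 * ((k choose 2) - (v choose 2)) = k * (k - 1) - v * (v - 1)"
    by (simp add: diff_mult_distrib2)
  also have "\<dots> = (k - v) * (k + v - 1)"
    unfolding k by (cases v; cases d) (auto simp: algebra_simps)
  finally show ?thesis .
qed

text \<open>A second clique meeting a given one in \<open>v\<close> vertices can be chosen in \<open>O(n\<^sup>k\<^sup>-\<^sup>v)\<close> ways and needs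
  \<open>(k - v)(k + v - 1)/2\<close> new edges. As \<open>v \<ge> 1\<close>, the latter number is at least \<open>(k - v) k / 2\<close>, so the
  clique contributes, up to a binomial coefficient, at most \<open>(n q\<^sup>k\<^sup>/\<^sup>2)\<^sup>k\<^sup>-\<^sup>v\<close>, written below as a square root to keep the exponents
  natural numbers.\<close>

lemma clique_overlap_bound:
  assumes q: "0 \<le> q" "q \<le> 1"
  shows "clique_overlap k n q \<le> clique_mean k n q * (\<Sum>v=1..<k. real (k choose v) * sqrt ((real n ^ 2 * q ^ k) ^ (k - v)))"
proof -
  let ?K = "nsets {1..n} k"
  have pair_weight: "q ^ card (nsets S 2 \<union> nsets T 2) = q ^ (k choose 2) * q ^ ((k choose 2) - (v choose 2))"
    if "S \<in> ?K" "T \<in> ?K" "card (S \<inter> T) = v" "v \<le> k" for S T v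
  proof -
    have "(v choose 2) \<le> (k choose 2)" using that(4) by (rule binomial_right_mono)
    moreover have "card (nsets S 2 \<union> nsets T 2) + (v choose 2) = (k choose 2) + (k choose 2)"
      using that card_nsets_2_Un[of S T] by (auto simp: nsets_def)
    ultimately have "card (nsets S 2 \<union> nsets T 2) = (k choose 2) + ((k choose 2) - (v choose 2))"
      by linarith
    then show ?thesis by (simp add: power_add)
  qed
  have weight: "real n ^ (k - v) * q ^ ((k choose 2) - (v choose 2)) \<le> sqrt ((real n ^ 2 * q ^ k) ^ (k - v))"
    if "v \<in> {1..<k}" for v
  proof (rule real_le_rsqrt)
    have "(real n ^ (k - v) * q ^ ((k choose 2) - (v choose 2)))\<^sup>2
        = (real n ^ 2) ^ (k - v) * q ^ ((k - v) * (k + v - 1))"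
      using that choose_two_diff[of v k] by (simp add: power_mult_distrib flip: power_mult) (simp add: mult.commute)
    also have "\<dots> \<le> (real n ^ 2) ^ (k - v) * q ^ ((k - v) * k)"
      using q that by (intro mult_left_mono power_decreasing) auto
    also have "\<dots> = (real n ^ 2 * q ^ k) ^ (k - v)"
      by (simp add: power_mult_distrib mult.commute flip: power_mult)
    finally show "(real n ^ (k - v) * q ^ ((k choose 2) - (v choose 2)))\<^sup>2 \<le> (real n ^ 2 * q ^ k) ^ (k - v)" .
  qed
  have inner: "(\<Sum>T\<in>{T \<in> ?K. T \<noteq> S \<and> S \<inter> T \<noteq> {}}. q ^ card (nsets S 2 \<union> nsets T 2))
      \<le> q ^ (k choose 2) * (\<Sum>v=1..<k. real (k choose v) * sqrt ((real n ^ 2 * q ^ k) ^ (k - v)))"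
    if S: "S \<in> ?K" for S
  proof -
    let ?N = "{T \<in> ?K. T \<noteq> S \<and> S \<inter> T \<noteq> {}}"
    have cS: "finite S" "card S = k" "S \<subseteq> {1..n}" using S by (auto simp: nsets_def)
    have range: "(\<lambda>T. card (S \<inter> T)) ` ?N \<subseteq> {1..<k}"
    proof (rule image_subsetI)
      fix T assume "T \<in> ?N"
      then have T: "T \<in> ?K" "T \<noteq> S" "S \<inter> T \<noteq> {}" by auto
      then have cT: "finite T" "card T = k" by (auto simp: nsets_def)
      have "S \<inter> T \<noteq> S" using T(2) cS cT by (metis Int_lower2 card_subset_eq)
      then have "card (S \<inter> T) < k" using cS by (metis Int_lower1 psubsetI psubset_card_mono)
      moreover have "0 < card (S \<inter> T)" using T(3) cS by (simp add: card_gt_0_iff)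
      ultimately show "card (S \<inter> T) \<in> {1..<k}" by simp
    qed
    have "(\<Sum>T\<in>?N. q ^ card (nsets S 2 \<union> nsets T 2))
        = (\<Sum>v\<in>{1..<k}. \<Sum>T\<in>{T \<in> ?N. card (S \<inter> T) = v}. q ^ card (nsets S 2 \<union> nsets T 2))"
      using range by (intro sum.group[symmetric]) (auto simp: finite_imp_finite_nsets)
    also have "\<dots> = (\<Sum>v\<in>{1..<k}. real (card {T \<in> ?N. card (S \<inter> T) = v})
        * (q ^ (k choose 2) * q ^ ((k choose 2) - (v choose 2))))"
    proof (intro sum.cong refl)
      fix v assume v: "v \<in> {1..<k}"
      have "(\<Sum>T\<in>{T \<in> ?N. card (S \<inter> T) = v}. q ^ card (nsets S 2 \<union> nsets T 2))
        = (\<Sum>T\<in>{T \<in> ?N. card (S \<inter> T) = v}. q ^ (k choose 2) * q ^ ((k choose 2) - (v choose 2)))"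
        using S v by (intro sum.cong refl pair_weight) auto
      then show "(\<Sum>T\<in>{T \<in> ?N. card (S \<inter> T) = v}. q ^ card (nsets S 2 \<union> nsets T 2))
        = real (card {T \<in> ?N. card (S \<inter> T) = v}) * (q ^ (k choose 2) * q ^ ((k choose 2) - (v choose 2)))"
        by simp
    qed
    also have "\<dots> \<le> (\<Sum>v\<in>{1..<k}. (real (k choose v) * real n ^ (k - v))
        * (q ^ (k choose 2) * q ^ ((k choose 2) - (v choose 2))))"
    proof (intro sum_mono mult_right_mono)
      fix v assume v: "v \<in> {1..<k}"
      have "card {T \<in> ?N. card (S \<inter> T) = v} \<le> card {T \<in> ?K. card (S \<inter> T) = v}"
        by (intro card_mono) (auto simp: finite_imp_finite_nsets)
      also have "\<dots> \<le> (k choose v) * n ^ (k - v)"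
        using card_nsets_meeting_in[of "{1..n}" S v k] cS v by simp
      finally have "real (card {T \<in> ?N. card (S \<inter> T) = v}) \<le> real ((k choose v) * n ^ (k - v))"
        by (rule of_nat_mono)
      then show "real (card {T \<in> ?N. card (S \<inter> T) = v}) \<le> real (k choose v) * real n ^ (k - v)"
        by (simp only: of_nat_mult of_nat_power)
    qed (use q in auto)
    also have "\<dots> = q ^ (k choose 2) * (\<Sum>v=1..<k. real (k choose v) * (real n ^ (k - v) * q ^ ((k choose 2) - (v choose 2))))"
      by (simp add: sum_distrib_left mult_ac)
    also have "\<dots> \<le> q ^ (k choose 2) * (\<Sum>v=1..<k. real (k choose v) * sqrt ((real n ^ 2 * q ^ k) ^ (k - v)))"
      using q weight by (intro mult_left_mono sum_mono) auto
    finally show ?thesis .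
  qed
  have "clique_overlap k n q \<le> (\<Sum>S\<in>?K. q ^ (k choose 2) * (\<Sum>v=1..<k. real (k choose v) * sqrt ((real n ^ 2 * q ^ k) ^ (k - v))))"
    unfolding clique_overlap_def by (intro sum_mono inner)
  then show ?thesis by (simp add: clique_mean_def)
qed

section \<open>Clique packings in a fixed random graph\<close>

text \<open>The variance of the absolute deviation is nonnegative.\<close>

lemma mean_abs_deviation_le:
  assumes "finite (set_pmf M)"
  shows "measure_pmf.expectation M (\<lambda>x. \<bar>Y x - measure_pmf.expectation M Y\<bar>)
    \<le> sqrt (measure_pmf.variance M Y)"
proof (rule real_le_rsqrt)
  let ?Z = "\<lambda>x. \<bar>Y x - measure_pmf.expectation M Y\<bar>"
  have "0 \<le> measure_pmf.variance M ?Z" by simp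
  also have "measure_pmf.variance M ?Z = measure_pmf.expectation M (\<lambda>x. (?Z x)\<^sup>2) - (measure_pmf.expectation M ?Z)\<^sup>2"
    using assms by (intro measure_pmf.variance_eq integrable_measure_pmf_finite)
  finally show "(measure_pmf.expectation M ?Z)\<^sup>2 \<le> measure_pmf.variance M Y" by simp
qed

text \<open>The inequality for finite sums, each factor carrying the square root of the weight.\<close>

lemma Cauchy_Schwarz_pmf_finite:
  fixes U V :: "'a \<Rightarrow> real"
  assumes "finite (set_pmf M)"
  shows "(measure_pmf.expectation M (\<lambda>x. U x * V x))\<^sup>2
    \<le> measure_pmf.expectation M (\<lambda>x. (U x)\<^sup>2) * measure_pmf.expectation M (\<lambda>x. (V x)\<^sup>2)"
proof -
  have E: "measure_pmf.expectation M f = (\<Sum>x\<in>set_pmf M. pmf M x * f x)" for f :: "'a \<Rightarrow> real"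
    using integral_measure_pmf[OF assms, of M f] by simp
  have "(\<Sum>x\<in>set_pmf M. (sqrt (pmf M x) * U x) * (sqrt (pmf M x) * V x))\<^sup>2
      \<le> (\<Sum>x\<in>set_pmf M. (sqrt (pmf M x) * U x)\<^sup>2) * (\<Sum>x\<in>set_pmf M. (sqrt (pmf M x) * V x)\<^sup>2)"
    by (rule Cauchy_Schwarz_ineq_sum)
  moreover have "(sqrt (pmf M x) * U x) * (sqrt (pmf M x) * V x) = pmf M x * (U x * V x)" for x
    using real_sqrt_mult_self[of "pmf M x"] by (simp add: mult_ac)
  ultimately show ?thesis by (simp add: E power_mult_distrib)
qed

lemma variance_diff_perturbation:
  fixes X Y :: "'a \<Rightarrow> real"
  assumes fin: "finite (set_pmf M)"
  shows "\<bar>measure_pmf.variance M (\<lambda>x. X x - Y x) - measure_pmf.variance M X\<bar>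
    \<le> measure_pmf.variance M Y + 2 * sqrt (measure_pmf.variance M X * measure_pmf.variance M Y)"
proof -
  note [simp] = integrable_measure_pmf_finite[OF fin]
  let ?E = "measure_pmf.expectation M :: ('a \<Rightarrow> real) \<Rightarrow> real"
  define U V where "U x = X x - ?E X" and "V x = Y x - ?E Y" for x
  have "measure_pmf.variance M (\<lambda>x. X x - Y x) = ?E (\<lambda>x. (U x)\<^sup>2 + (V x)\<^sup>2 - 2 * (U x * V x))"
    by (intro integral_cong_AE) (simp_all add: U_def V_def power2_eq_square algebra_simps)
  also have "\<dots> = measure_pmf.variance M X + measure_pmf.variance M Y - 2 * ?E (\<lambda>x. U x * V x)"
    by (simp add: U_def V_def)
  finally have eq: "measure_pmf.variance M (\<lambda>x. X x - Y x)
      = measure_pmf.variance M X + measure_pmf.variance M Y - 2 * ?E (\<lambda>x. U x * V x)" .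
  have "\<bar>?E (\<lambda>x. U x * V x)\<bar> \<le> sqrt (measure_pmf.variance M X * measure_pmf.variance M Y)"
    using Cauchy_Schwarz_pmf_finite[OF fin, of U V]
    by (intro real_le_rsqrt) (simp add: U_def V_def)
  moreover have "0 \<le> measure_pmf.variance M Y" by simp
  ultimately show ?thesis unfolding eq by linarith
qed

abbreviation clique_count :: "nat \<Rightarrow> nat \<Rightarrow> nat set set \<Rightarrow> real" where
  "clique_count k n G \<equiv> real (card (clique_copies k ({1..n}, G)))"

abbreviation edge_model :: "nat \<Rightarrow> real \<Rightarrow> nat set set pmf" where
  "edge_model n q \<equiv> random_subset (nsets {1..n} 2) q"

lemma gnp_eq_edge_model: "gnp n q = map_pmf (\<lambda>G. ({1..n}, G)) (edge_model n q)"
  by (simp add: gnp_def random_subset_def pmf.map_comp o_def)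

context
  fixes k n :: nat and q :: real
  assumes q: "0 \<le> q" "q \<le> 1"
begin

lemma clique_family: "random_subset_family (nsets {1..n} 2) q (nsets {1..n} k) (\<lambda>S. nsets S 2)"
  using q by unfold_locales (auto simp: finite_imp_finite_nsets nsets_def)

lemma card_edges: "S \<in> nsets {1..n} k \<Longrightarrow> card (nsets S 2) = k choose 2"
  by (simp add: nsets_def[of _ k])

lemma count_eq: "random_subset_family.count (nsets {1..n} k) (\<lambda>S. nsets S 2) = clique_count k n"
  unfolding random_subset_family.count_def[OF clique_family] clique_copies_def by simp

lemma mean_count_eq: "random_subset_family.mean_count q (nsets {1..n} k) (\<lambda>S. nsets S 2) = clique_mean k n q"
  unfolding random_subset_family.mean_count_def[OF clique_family] clique_mean_def by (simp only: card_edges cong: sum.cong) simp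

lemma clique_overlap_nonneg: "0 \<le> clique_overlap k n q"
  unfolding clique_overlap_def using q by (intro sum_nonneg) auto

text \<open>Cliques with a common edge have a common vertex, so the overlap bounds the dependence between edge sets.\<close>

lemma dependence_le:
  "random_subset_family.dependence q (nsets {1..n} k) (\<lambda>S. nsets S 2)
    \<le> clique_mean k n q * q ^ (k choose 2) + clique_overlap k n q"
proof -
  interpret F: random_subset_family "nsets {1..n} 2" q "nsets {1..n} k" "\<lambda>S. nsets S 2"
    by (rule clique_family)
  have "F.dependence \<le> (\<Sum>S\<in>nsets {1..n} k. (q ^ (k choose 2))\<^sup>2
     + (\<Sum>T\<in>{T \<in> nsets {1..n} k. T \<noteq> S \<and> S \<inter> T \<noteq> {}}. q ^ card (nsets S 2 \<union> nsets T 2)))"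
    unfolding F.dependence_def
  proof (intro sum_mono add_mono sum_mono2)
    fix S assume "S \<in> nsets {1..n} k"
    then show "(q ^ card (nsets S 2))\<^sup>2 \<le> (q ^ (k choose 2))\<^sup>2" by (simp only: card_edges)
    show "F.neighbours S \<subseteq> {T \<in> nsets {1..n} k. T \<noteq> S \<and> S \<inter> T \<noteq> {}}"
    proof
      fix T assume "T \<in> F.neighbours S"
      then obtain e where "T \<in> nsets {1..n} k" "T \<noteq> S" "e \<in> nsets S 2" "e \<in> nsets T 2"
        unfolding F.neighbours_def by blast
      moreover from this have "e \<subseteq> S \<inter> T" "e \<noteq> {}" by (auto simp: nsets_def)
      ultimately show "T \<in> {T \<in> nsets {1..n} k. T \<noteq> S \<and> S \<inter> T \<noteq> {}}" by auto
    qed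
  qed (use q in \<open>auto simp: finite_imp_finite_nsets\<close>)
  also have "\<dots> = clique_mean k n q * q ^ (k choose 2) + clique_overlap k n q"
    by (simp add: sum.distrib clique_overlap_def clique_mean_def power2_eq_square)
  finally show ?thesis .
qed

lemma clique_count_mean: "subset_mean (nsets {1..n} 2) q (clique_count k n) = clique_mean k n q"
  using random_subset_family.mean_of_count[OF clique_family] by (simp only: count_eq mean_count_eq)

lemma clique_count_variance:
  "\<bar>measure_pmf.variance (edge_model n q) (clique_count k n) - clique_mean k n q\<bar>
    \<le> clique_mean k n q * q ^ (k choose 2) + clique_overlap k n q"
  using order.trans[OF random_subset_family.variance_count[OF clique_family] dependence_le]
  by (simp only: count_eq mean_count_eq)

lemma clique_count_char:
  assumes "0 < clique_mean k n q"
  shows "norm (subset_mean (nsets {1..n} 2) q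
        (\<lambda>G. iexp (t * ((clique_count k n G - clique_mean k n q) / sqrt (clique_mean k n q))))
      - of_real (exp (- t\<^sup>2 / 2)))
    \<le> (t\<^sup>2 / (2 * sqrt (clique_mean k n q))
        + \<bar>t\<bar> * (q ^ (k choose 2) + clique_overlap k n q / clique_mean k n q)) * \<bar>t\<bar>"
proof -
  interpret F: random_subset_family "nsets {1..n} 2" q "nsets {1..n} k" "\<lambda>S. nsets S 2"
    by (rule clique_family)
  let ?\<mu> = "clique_mean k n q"
  have "\<bar>t\<bar> * F.dependence / ?\<mu> \<le> \<bar>t\<bar> * (?\<mu> * q ^ (k choose 2) + clique_overlap k n q) / ?\<mu>"
    using assms dependence_le by (intro divide_right_mono mult_left_mono) auto
  also have "\<dots> = \<bar>t\<bar> * (q ^ (k choose 2) + clique_overlap k n q / ?\<mu>)"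
    using assms by (simp add: field_simps)
  finally have "(t\<^sup>2 / (2 * sqrt ?\<mu>) + \<bar>t\<bar> * F.dependence / ?\<mu>) * \<bar>t\<bar>
      \<le> (t\<^sup>2 / (2 * sqrt ?\<mu>) + \<bar>t\<bar> * (q ^ (k choose 2) + clique_overlap k n q / ?\<mu>)) * \<bar>t\<bar>"
    by (intro mult_right_mono) auto
  with F.char_count_approx[unfolded mean_count_eq count_eq, OF assms, of t] show ?thesis
    by (rule order.trans)
qed

abbreviation packing :: "nat set set \<Rightarrow> real" where
  "packing G \<equiv> real (clique_packing_number k ({1..n}, G))"

lemma packing_eq: "packing G = clique_count k n G - packing_deficit (clique_copies k ({1..n}, G))"
  by (simp add: packing_deficit_def clique_packing_number_eq)

text \<open>Perturbation of the clique count by the deficit, whose variance is at most \<open>\<rho>\<close> times the mean of the count.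
  The number \<open>\<delta>\<close> bounds the relative error of the variance of the count itself.\<close>

lemma packing_variance:
  assumes "0 < clique_mean k n q"
  defines "\<delta> \<equiv> q ^ (k choose 2) + clique_overlap k n q / clique_mean k n q"
    and "\<rho> \<equiv> 2 * real (k choose 2) * (clique_overlap k n q / clique_mean k n q)"
  shows "\<bar>measure_pmf.variance (edge_model n q) packing / clique_mean k n q - 1\<bar>
    \<le> \<delta> + \<rho> + 2 * sqrt ((1 + \<delta>) * \<rho>)"
proof -
  let ?\<mu> = "clique_mean k n q"
  let ?D = "\<lambda>G. packing_deficit (clique_copies k ({1..n}, G))"
  let ?V = "\<lambda>f. measure_pmf.variance (edge_model n q) f"
  have D: "?V ?D / ?\<mu> \<le> \<rho>"
    using variance_packing_deficit[OF q, of n k] assms by (simp add: \<rho>_def field_simps)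
  have X: "\<bar>?V (clique_count k n) / ?\<mu> - 1\<bar> \<le> \<delta>"
  proof -
    have "\<bar>?V (clique_count k n) / ?\<mu> - 1\<bar> = \<bar>?V (clique_count k n) - ?\<mu>\<bar> / ?\<mu>"
    proof -
      have "?V (clique_count k n) / ?\<mu> - 1 = (?V (clique_count k n) - ?\<mu>) / ?\<mu>"
        using assms(1) by (simp add: diff_divide_distrib)
      then show ?thesis using assms(1) by simp
    qed
    also have "\<dots> \<le> (?\<mu> * q ^ (k choose 2) + clique_overlap k n q) / ?\<mu>"
      using clique_count_variance assms(1) by (intro divide_right_mono) auto
    also have "\<dots> = \<delta>" using assms(1) by (simp add: \<delta>_def field_simps)
    finally show ?thesis .
  qed
  have nn: "0 \<le> ?V f / ?\<mu>" for f using assms(1) by (intro divide_nonneg_pos) auto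
  have "\<bar>?V packing - ?V (clique_count k n)\<bar> \<le> ?V ?D + 2 * sqrt (?V (clique_count k n) * ?V ?D)"
    unfolding packing_eq by (rule variance_diff_perturbation) (simp add: finite_imp_finite_nsets)
  then have "\<bar>?V packing - ?V (clique_count k n)\<bar> / ?\<mu>
      \<le> (?V ?D + 2 * sqrt (?V (clique_count k n) * ?V ?D)) / ?\<mu>"
    using assms(1) by (intro divide_right_mono) auto
  also have "\<dots> = ?V ?D / ?\<mu> + 2 * sqrt ((?V (clique_count k n) / ?\<mu>) * (?V ?D / ?\<mu>))"
    using assms(1) by (simp add: real_sqrt_divide real_sqrt_mult add_divide_distrib)
  also have "\<dots> \<le> \<rho> + 2 * sqrt ((1 + \<delta>) * \<rho>)"
    using D X nn[of ?D] nn[of "clique_count k n"]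
    by (intro add_mono mult_left_mono real_sqrt_le_mono mult_mono) auto
  finally have perturbation: "\<bar>?V packing / ?\<mu> - ?V (clique_count k n) / ?\<mu>\<bar> \<le> \<rho> + 2 * sqrt ((1 + \<delta>) * \<rho>)"
    using assms(1) by (simp add: abs_divide flip: diff_divide_distrib)
  have triangle: "\<bar>a - 1\<bar> \<le> v + w + z" if "\<bar>b - 1\<bar> \<le> v" "\<bar>a - b\<bar> \<le> w + z" for a b v w z :: real
    using that by linarith
  show ?thesis by (rule triangle[OF X perturbation])
qed

text \<open>The exponential is Lipschitz, so replacing the packing number by the clique count
  costs at most \<open>\<bar>t\<bar>\<close> times the mean absolute deviation of the deficit on the scale \<open>sqrt \<mu>\<close>.\<close>

lemma packing_char:
  assumes "0 < clique_mean k n q"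
  defines "\<delta> \<equiv> q ^ (k choose 2) + clique_overlap k n q / clique_mean k n q"
    and "\<rho> \<equiv> 2 * real (k choose 2) * (clique_overlap k n q / clique_mean k n q)"
  shows "norm (subset_mean (nsets {1..n} 2) q
        (\<lambda>G. iexp (t * ((packing G - subset_mean (nsets {1..n} 2) q packing) / sqrt (clique_mean k n q))))
      - of_real (exp (- t\<^sup>2 / 2)))
    \<le> \<bar>t\<bar> * sqrt \<rho> + (t\<^sup>2 / (2 * sqrt (clique_mean k n q)) + \<bar>t\<bar> * \<delta>) * \<bar>t\<bar>"
proof -
  let ?A = "nsets {1..n} 2"
  let ?\<mu> = "clique_mean k n q"
  let ?D = "\<lambda>G. packing_deficit (clique_copies k ({1..n}, G))"
  let ?V = "\<lambda>f. measure_pmf.variance (edge_model n q) f"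
  let ?W = "\<lambda>G. (clique_count k n G - ?\<mu>) / sqrt ?\<mu>"
  let ?Y = "\<lambda>G. (packing G - subset_mean ?A q packing) / sqrt ?\<mu>"
  have diff: "?Y G - ?W G = - (?D G - subset_mean ?A q ?D) / sqrt ?\<mu>" for G
  proof -
    have "subset_mean ?A q packing = ?\<mu> - subset_mean ?A q ?D"
      unfolding packing_eq clique_count_mean[symmetric]
      by (intro Bochner_Integration.integral_diff integrable_random_subset)
        (simp_all add: finite_imp_finite_nsets)
    then show ?thesis by (simp only: packing_eq flip: diff_divide_distrib) simp
  qed
  have "norm (subset_mean ?A q (\<lambda>G. iexp (t * ?Y G)) - subset_mean ?A q (\<lambda>G. iexp (t * ?W G)))
      = norm (subset_mean ?A q (\<lambda>G. iexp (t * ?Y G) - iexp (t * ?W G)))"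
    by (intro arg_cong[where f = norm] Bochner_Integration.integral_diff[symmetric]
          integrable_random_subset) (simp_all add: finite_imp_finite_nsets)
  also have "\<dots> \<le> subset_mean ?A q (\<lambda>G. norm (iexp (t * ?Y G) - iexp (t * ?W G)))"
    by (rule integral_norm_bound)
  also have "\<dots> \<le> subset_mean ?A q (\<lambda>G. \<bar>t\<bar> / sqrt ?\<mu> * \<bar>?D G - subset_mean ?A q ?D\<bar>)"
  proof (rule subset_mean_mono)
    fix G
    have "norm (iexp (t * ?Y G) - iexp (t * ?W G)) \<le> \<bar>t * ?Y G - t * ?W G\<bar>"
      by (rule iexp_Lipschitz)
    also have "\<dots> = \<bar>t\<bar> * \<bar>?Y G - ?W G\<bar>"
      by (simp only: abs_mult right_diff_distrib[symmetric])
    also have "\<dots> = \<bar>t\<bar> / sqrt ?\<mu> * \<bar>?D G - subset_mean ?A q ?D\<bar>"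
      unfolding diff using assms(1) by (simp add: abs_mult abs_divide abs_minus_commute)
    finally show "norm (iexp (t * ?Y G) - iexp (t * ?W G)) \<le> \<bar>t\<bar> / sqrt ?\<mu> * \<bar>?D G - subset_mean ?A q ?D\<bar>" .
  qed (simp add: finite_imp_finite_nsets)
  also have "\<dots> = \<bar>t\<bar> / sqrt ?\<mu> * subset_mean ?A q (\<lambda>G. \<bar>?D G - subset_mean ?A q ?D\<bar>)"
    by (rule integral_mult_right_zero)
  also have "\<dots> \<le> \<bar>t\<bar> / sqrt ?\<mu> * sqrt (?V ?D)"
    using assms(1) by (intro mult_left_mono mean_abs_deviation_le finite_set_random_subset)
      (auto simp: finite_imp_finite_nsets)
  also have "\<dots> = \<bar>t\<bar> * sqrt (?V ?D / ?\<mu>)"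
    by (simp add: real_sqrt_divide)
  also have "\<dots> \<le> \<bar>t\<bar> * sqrt \<rho>"
    using variance_packing_deficit[OF q, of n k] assms(1)
    by (intro mult_left_mono real_sqrt_le_mono) (auto simp: \<rho>_def field_simps)
  finally have "norm (subset_mean ?A q (\<lambda>G. iexp (t * ?Y G)) - subset_mean ?A q (\<lambda>G. iexp (t * ?W G)))
      \<le> \<bar>t\<bar> * sqrt \<rho>" .
  from norm_diff_triangle_le[OF this clique_count_char[OF assms(1), of t, folded \<delta>_def]]
  show ?thesis .
qed

end

section \<open>The limit\<close>

lemma powr_minus_2_divide_power:
  assumes "0 < n" "0 < m"
  shows "(real n powr (- 2 / real m)) ^ m = inverse ((real n)\<^sup>2)"
proof -
  have "(real n powr (- 2 / real m)) ^ m = real n powr (- 2)"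
    using assms by (simp add: powr_power)
  then show ?thesis using assms by (simp add: powr_minus)
qed

context
  fixes k :: nat and q :: "nat \<Rightarrow> real"
  assumes k: "2 \<le> k"
    and q: "\<And>n. 0 \<le> q n \<and> q n \<le> 1"
    and lower: "(\<lambda>n. real n powr (- 2 / (real k - 1))) \<in> o(q)"
    and upper: "q \<in> o(\<lambda>n. real n powr (- 2 / real k))"
begin

lemma eventually_q_pos: "eventually (\<lambda>n. 0 < q n) sequentially"
proof -
  have "eventually (\<lambda>n. norm (real n powr (- 2 / (real k - 1))) \<le> 1 * norm (q n)) sequentially"
    using landau_o.smallD[OF lower, of 1] by simp
  then show ?thesis using eventually_gt_at_top[of 0]
  proof eventually_elim
    case (elim n)
    then have "0 < norm (real n powr (- 2 / (real k - 1)))" by simp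
    then have "0 < norm (q n)" using elim(1) by linarith
    then show ?case using q[of n] by simp
  qed
qed

text \<open>This is the \<open>k\<close>-th power of the ratio in the upper bound on \<open>q\<close>, and the base of all terms of
  \<open>clique_overlap_bound\<close>.\<close>

lemma upper_ratio_tendsto_0: "(\<lambda>n. (real n)\<^sup>2 * q n ^ k) \<longlonglongrightarrow> 0"
proof -
  have "(\<lambda>n. (q n / real n powr (- 2 / real k)) ^ k) \<longlonglongrightarrow> 0 ^ k"
    by (intro tendsto_power smalloD_tendsto[OF upper])
  moreover have "eventually (\<lambda>n. (q n / real n powr (- 2 / real k)) ^ k = (real n)\<^sup>2 * q n ^ k) sequentially"
    using eventually_gt_at_top[of 0]
  proof eventually_elim
    case (elim n)
    then have "(real n powr (- 2 / real k)) ^ k = inverse ((real n)\<^sup>2)"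
      using k by (intro powr_minus_2_divide_power) auto
    then show ?case unfolding power_divide by (simp only:) (simp add: divide_inverse)
  qed
  ultimately have "(\<lambda>n. (real n)\<^sup>2 * q n ^ k) \<longlonglongrightarrow> 0 ^ k"
    by (rule Lim_transform_eventually)
  then show ?thesis
    using k by (simp add: power_0_left)
qed

lemma q_tendsto_0: "q \<longlonglongrightarrow> 0"
proof -
  have "(\<lambda>n. real n powr (- 2 / real k)) \<longlonglongrightarrow> 0"
    using k by (intro tendsto_neg_powr filterlim_real_sequentially) simp
  from tendsto_mult[OF smalloD_tendsto[OF upper] this]
  have "(\<lambda>n. q n / real n powr (- 2 / real k) * real n powr (- 2 / real k)) \<longlonglongrightarrow> 0" by simp
  moreover have "eventually (\<lambda>n. q n / real n powr (- 2 / real k) * real n powr (- 2 / real k) = q n) sequentially"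
    using eventually_gt_at_top[of 0] by eventually_elim simp
  ultimately show ?thesis by (rule Lim_transform_eventually)
qed

text \<open>Up to a constant factor, \<open>\<mu>\<^sup>2\<close> is at least \<open>(n\<^sup>2 q\<^sup>k\<^sup>-\<^sup>1)\<^sup>k\<close>, and \<open>n\<^sup>2 q\<^sup>k\<^sup>-\<^sup>1\<close> is the \<open>(k - 1)\<close>-st power of the
  reciprocal of the ratio in the lower bound on \<open>q\<close>.\<close>

lemma clique_mean_at_top: "filterlim (\<lambda>n. clique_mean k n (q n)) at_top sequentially"
proof -
  have "(\<lambda>n. (real n powr (- 2 / (real k - 1)) / q n) ^ (k - 1)) \<longlonglongrightarrow> 0 ^ (k - 1)"
    by (intro tendsto_power smalloD_tendsto[OF lower])
  moreover have "eventually (\<lambda>n. (real n powr (- 2 / (real k - 1)) / q n) ^ (k - 1)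
      = inverse ((real n)\<^sup>2 * q n ^ (k - 1))) sequentially"
    using eventually_gt_at_top[of 0]
  proof eventually_elim
    case (elim n)
    have "real k - 1 = real (k - 1)" using k by simp
    then have "(real n powr (- 2 / (real k - 1))) ^ (k - 1) = inverse ((real n)\<^sup>2)"
      using elim k by (simp only: powr_minus_2_divide_power)
    then show ?case unfolding power_divide by (simp only:) (simp add: divide_inverse)
  qed
  ultimately have "(\<lambda>n. inverse ((real n)\<^sup>2 * q n ^ (k - 1))) \<longlonglongrightarrow> 0 ^ (k - 1)"
    by (rule Lim_transform_eventually)
  moreover have "(0 :: real) ^ (k - 1) = 0" using k by (simp add: power_0_left)
  ultimately have "(\<lambda>n. inverse ((real n)\<^sup>2 * q n ^ (k - 1))) \<longlonglongrightarrow> 0" by (simp only:)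
  moreover have "eventually (\<lambda>n. 0 < (real n)\<^sup>2 * q n ^ (k - 1)) sequentially"
    using eventually_q_pos eventually_gt_at_top[of 0] by eventually_elim simp
  then have "eventually (\<lambda>n. 0 < inverse ((real n)\<^sup>2 * q n ^ (k - 1))) sequentially"
    by eventually_elim (rule positive_imp_inverse_positive)
  ultimately have "filterlim (\<lambda>n. inverse (inverse ((real n)\<^sup>2 * q n ^ (k - 1)))) at_top sequentially"
    by (rule filterlim_inverse_at_top)
  then have b: "filterlim (\<lambda>n. (real n)\<^sup>2 * q n ^ (k - 1)) at_top sequentially" by simp
  have sq: "filterlim (\<lambda>n. sqrt ((real n)\<^sup>2 * q n ^ (k - 1))) at_top sequentially"
    by (rule filterlim_compose[OF sqrt_at_top b])
  have "filterlim (\<lambda>n. inverse (real k ^ k) * sqrt ((real n)\<^sup>2 * q n ^ (k - 1))) at_top sequentially"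
    by (rule filterlim_tendsto_pos_mult_at_top[OF tendsto_const _ sq]) (use k in simp)
  moreover have "eventually (\<lambda>n. inverse (real k ^ k) * sqrt ((real n)\<^sup>2 * q n ^ (k - 1))
      \<le> clique_mean k n (q n)) sequentially"
    using eventually_ge_at_top[of k] filterlim_at_top[THEN iffD1, OF b, rule_format, of 1]
  proof eventually_elim
    case (elim n)
    let ?b = "(real n)\<^sup>2 * q n ^ (k - 1)"
    have "sqrt ?b \<le> real n ^ k * q n ^ (k choose 2)"
    proof (rule real_le_lsqrt)
      have "k * (k - 1) = (k choose 2) * 2" by (cases k) (simp_all add: choose_two)
      then have "(real n ^ k * q n ^ (k choose 2))\<^sup>2 = ?b ^ k"
        by (simp add: power_mult_distrib mult.commute flip: power_mult)
      moreover have "?b \<le> ?b ^ k" using elim(2) k by (intro self_le_power) auto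
      ultimately show "?b \<le> (real n ^ k * q n ^ (k choose 2))\<^sup>2" by simp
    qed (use q in auto)
    then have "inverse (real k ^ k) * sqrt ?b \<le> (real n / real k) ^ k * q n ^ (k choose 2)"
      using k by (simp add: power_divide field_simps)
    also have "\<dots> \<le> real (n choose k) * q n ^ (k choose 2)"
      using binomial_ge_n_over_k_pow_k[OF elim(1), where 'a = real] q
      by (intro mult_right_mono) auto
    finally show ?case by (simp add: clique_mean_def)
  qed
  ultimately show ?thesis by (rule filterlim_at_top_mono)
qed

lemma eventually_clique_mean_pos: "eventually (\<lambda>n. 0 < clique_mean k n (q n)) sequentially"
  using clique_mean_at_top by (simp add: filterlim_at_top_dense)

lemma overlap_ratio_tendsto_0: "(\<lambda>n. clique_overlap k n (q n) / clique_mean k n (q n)) \<longlonglongrightarrow> 0"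
proof (rule tendsto_sandwich)
  let ?B = "\<lambda>n. \<Sum>v=1..<k. real (k choose v) * sqrt (((real n)\<^sup>2 * q n ^ k) ^ (k - v))"
  show "eventually (\<lambda>n. 0 \<le> clique_overlap k n (q n) / clique_mean k n (q n)) sequentially"
    using eventually_clique_mean_pos
    by eventually_elim (use q clique_overlap_nonneg in \<open>auto intro!: divide_nonneg_pos\<close>)
  show "eventually (\<lambda>n. clique_overlap k n (q n) / clique_mean k n (q n) \<le> ?B n) sequentially"
    using eventually_clique_mean_pos
  proof eventually_elim
    case (elim n)
    then show ?case
      using clique_overlap_bound[of "q n" k n] q by (simp add: pos_divide_le_eq mult.commute)
  qed
  have "?B \<longlonglongrightarrow> (\<Sum>v=1..<k. real (k choose v) * sqrt (0 ^ (k - v)))"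
    by (intro tendsto_intros upper_ratio_tendsto_0)
  also have "(\<Sum>v=1..<k. real (k choose v) * sqrt (0 ^ (k - v))) = 0"
    by (intro sum.neutral) (auto simp: power_0_left)
  finally show "?B \<longlonglongrightarrow> 0" .
qed simp

abbreviation \<delta> :: "nat \<Rightarrow> real" where
  "\<delta> n \<equiv> q n ^ (k choose 2) + clique_overlap k n (q n) / clique_mean k n (q n)"
abbreviation \<rho> :: "nat \<Rightarrow> real" where
  "\<rho> n \<equiv> 2 * real (k choose 2) * (clique_overlap k n (q n) / clique_mean k n (q n))"

lemma \<delta>_tendsto_0: "\<delta> \<longlonglongrightarrow> 0"
proof -
  have "0 < (k choose 2)" using k by (simp add: zero_less_binomial_iff)
  then show ?thesis
    using tendsto_add[OF tendsto_power[OF q_tendsto_0, of "k choose 2"] overlap_ratio_tendsto_0]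
    by (simp add: power_0_left)
qed

lemma \<rho>_tendsto_0: "\<rho> \<longlonglongrightarrow> 0"
  using tendsto_mult[OF tendsto_const overlap_ratio_tendsto_0, of "2 * real (k choose 2)"] by simp

lemma packing_variance_asymp:
  "(\<lambda>n. measure_pmf.variance (gnp n (q n)) (\<lambda>H. real (clique_packing_number k H)))
     \<sim>[sequentially] (\<lambda>n. clique_mean k n (q n))"
proof (rule asymp_equivI')
  let ?r = "\<lambda>n. measure_pmf.variance (gnp n (q n)) (\<lambda>H. real (clique_packing_number k H))
      / clique_mean k n (q n)"
  let ?e = "\<lambda>n. \<delta> n + \<rho> n + 2 * sqrt ((1 + \<delta> n) * \<rho> n)"
  have "?e \<longlonglongrightarrow> 0 + 0 + 2 * sqrt ((1 + 0) * 0)"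
    by (intro tendsto_intros \<delta>_tendsto_0 \<rho>_tendsto_0)
  then have "?e \<longlonglongrightarrow> 0" by simp
  moreover have "eventually (\<lambda>n. norm (?r n - 1) \<le> ?e n) sequentially"
    using eventually_clique_mean_pos
  proof eventually_elim
    case (elim n)
    show ?case
      using packing_variance[OF _ _ elim] q[of n] by (simp only: gnp_eq_edge_model integral_map_pmf real_norm_def)
  qed
  ultimately have "(\<lambda>n. ?r n - 1) \<longlonglongrightarrow> 0" by (rule Lim_null_comparison[rotated])
  then show "?r \<longlonglongrightarrow> 1" by (rule LIM_zero_cancel)
qed

lemma packing_weak_conv:
  "weak_conv_m
     (\<lambda>n. distr (measure_pmf (gnp n (q n))) borel
        (\<lambda>H. (real (clique_packing_number k H)
                - measure_pmf.expectation (gnp n (q n)) (\<lambda>H. real (clique_packing_number k H)))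
              / sqrt (clique_mean k n (q n))))
     std_normal_distribution"
proof (rule levy_continuity)
  let ?Y = "\<lambda>n H. (real (clique_packing_number k H)
      - measure_pmf.expectation (gnp n (q n)) (\<lambda>H. real (clique_packing_number k H)))
      / sqrt (clique_mean k n (q n))"
  show "real_distribution (distr (measure_pmf (gnp n (q n))) borel (?Y n))" for n
    unfolding real_distribution_def real_distribution_axioms_def
    by (auto intro!: measure_pmf.prob_space_distr)
  show "real_distribution std_normal_distribution" by (rule real_dist_normal_dist)
  fix t
  let ?c = "\<lambda>n. char (distr (measure_pmf (gnp n (q n))) borel (?Y n)) t"
  have c: "?c n = measure_pmf.expectation (gnp n (q n)) (\<lambda>H. iexp (t * ?Y n H))" for n
    unfolding char_def by (rule integral_distr) auto
  let ?e = "\<lambda>n. \<bar>t\<bar> * sqrt (\<rho> n) + (t\<^sup>2 * inverse (2 * sqrt (clique_mean k n (q n))) + \<bar>t\<bar> * \<delta> n) * \<bar>t\<bar>"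
  have "filterlim (\<lambda>n. 2 * sqrt (clique_mean k n (q n))) at_top sequentially"
    by (intro filterlim_tendsto_pos_mult_at_top[OF tendsto_const]
          filterlim_compose[OF sqrt_at_top clique_mean_at_top]) simp
  then have "(\<lambda>n. inverse (2 * sqrt (clique_mean k n (q n)))) \<longlonglongrightarrow> 0"
    by (rule tendsto_inverse_0_at_top)
  then have "?e \<longlonglongrightarrow> \<bar>t\<bar> * sqrt 0 + (t\<^sup>2 * 0 + \<bar>t\<bar> * 0) * \<bar>t\<bar>"
    by (intro tendsto_add tendsto_mult tendsto_const tendsto_real_sqrt \<delta>_tendsto_0 \<rho>_tendsto_0)
  then have "?e \<longlonglongrightarrow> 0" by simp
  moreover have "eventually (\<lambda>n. norm (?c n - of_real (exp (- t\<^sup>2 / 2))) \<le> ?e n) sequentially"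
    using eventually_clique_mean_pos
  proof eventually_elim
    case (elim n)
    show ?case
      using packing_char[OF _ _ elim, of t] q[of n] unfolding c
      by (simp only: gnp_eq_edge_model integral_map_pmf flip: divide_inverse)
  qed
  ultimately have "(\<lambda>n. ?c n - of_real (exp (- t\<^sup>2 / 2))) \<longlonglongrightarrow> 0" by (rule Lim_null_comparison[rotated])
  then have "?c \<longlonglongrightarrow> of_real (exp (- t\<^sup>2 / 2))" by (rule LIM_zero_cancel)
  then show "?c \<longlonglongrightarrow> char std_normal_distribution t"
    by (simp add: char_std_normal_distribution)
qed

end

theorem theorem1p4:
  fixes k :: nat and q :: "nat \<Rightarrow> real"
  assumes "k \<ge> 2"
    and "\<And>n. 0 \<le> q n \<and> q n \<le> 1"
    and "(\<lambda>n. real n powr (- 2 / (real k - 1))) \<in> o(q)"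
    and "q \<in> o(\<lambda>n. real n powr (- 2 / real k))"
  shows "weak_conv_m
           (\<lambda>n. distr (measure_pmf (gnp n (q n))) borel
              (\<lambda>H. (real (clique_packing_number k H)
                      - measure_pmf.expectation (gnp n (q n)) (\<lambda>H. real (clique_packing_number k H)))
                    / sqrt (clique_mean k n (q n))))
           std_normal_distribution
       \<and> (\<lambda>n. measure_pmf.variance (gnp n (q n)) (\<lambda>H. real (clique_packing_number k H)))
           \<sim>[sequentially] (\<lambda>n. clique_mean k n (q n))"
  by (rule conjI[OF packing_weak_conv[OF assms] packing_variance_asymp[OF assms]])

end
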